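(* Let $\mathcal Z_\nu$ be the Zorich map described in the context with $\lambda>L^5$ and $\nu>\sqrt{2L/\lambda}$. Then the escaping set $I(\mathcal Z_\nu)=\{x\in\mathbb R^3:|\mathcal Z_\nu^n(x)|\to\infty\text{ as }n\to\infty\}$ is a connected subset of $\mathbb R^3$.
   Context: Zorich maps. Let $Q=\{(x_1,x_2)\in\mathbb R^2:|x_1|\le1,|x_2|\le1\}$. Let $L\ge1$ and let $\mathfrak h=(\mathfrak h_1,\mathfrak h_2,\mathfrak h_3)$ be a sense-preserving $L$-bi-Lipschitz map (i.e. $|a-b|/L\le|\mathfrak h(a)-\mathfrak h(b)|\le L|a-b|$) of $Q$ onto the closed upper unit hemisphere $\{x\in\mathbb R^3:|x|=1,x_3\ge0\}$, with $\partial Q$ mapped onto the equator. Assume $\mathfrak h_1(t,t)=\mathfrak h_2(t,t)$ and $\mathfrak h_1(t,-t)=-\mathfrak h_2(t,-t)$ for $t\in[-1,1]$ (so $\mathfrak h(0,0)=(0,0,1)$). Let $\lambda\ge1$ and $h(x_1,x_2)=\lambda\mathfrak h(x_1/\lambda,x_2/\lambda)$ on $\lambda Q=[-\lambda,\lambda]^2$. For $\nu>0$ set $\mathcal Z_\nu(x_1,x_2,x_3)=\nu e^{x_3}h(x_1,x_2)$ on $\lambda Q\times\mathbb R$ (which is mapped onto $\{x_3\ge0\}$), and extend $\mathcal Z_\nu$ to $\mathbb R^3$ by repeated reflection: in the domain across the faces $x_1=(2k+1)\lambda$, $x_2=(2k+1)\lambda$ ($k\in\mathbb Z$) of the beams,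 and in the range across the plane $x_3=0$. The resulting $\mathcal Z_\nu:\mathbb R^3\to\mathbb R^3$ is quasiregular with an essential singularity at infinity. *)

theory Defs
  imports "HOL-Analysis.Analysis"
begin

definition sqQ :: "(real^2) set" where
  "sqQ = {x. \<bar>x$1\<bar> \<le> 1 \<and> \<bar>x$2\<bar> \<le> 1}"

definition upper_hemisphere :: "(real^3) set" where
  "upper_hemisphere = {y. norm y = 1 \<and> y$3 \<ge> 0}"

definition equator :: "(real^3) set" where
  "equator = {y. norm y = 1 \<and> y$3 = 0}"

definition pt2 :: "real \<Rightarrow> real \<Rightarrow> real^2" where
  "pt2 a b = (\<chi> i. if i = 1 then a else b)"

text \<open>Sense-preserving (orientation-preserving) for a Lipschitz map of Q into the unit sphere,
  where the sphere is oriented by the outward normal: at almost every interior point the map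
  is differentiable and the frame (d_1 h, d_2 h, h) is positively oriented.\<close>
definition sense_preserving_to_sphere :: "(real^2 \<Rightarrow> real^3) \<Rightarrow> bool" where
  "sense_preserving_to_sphere hh \<longleftrightarrow>
     (AE u in lebesgue. u \<in> interior sqQ \<longrightarrow>
        (\<exists>D. (hh has_derivative D) (at u) \<and>
           det (\<chi> i j. if j = 1 then D (axis 1 1) $ i
                         else if j = 2 then D (axis 2 1) $ i
                         else hh u $ i :: real^3^3) > 0))"

definition zorich_base :: "real \<Rightarrow> (real^2 \<Rightarrow> real^3) \<Rightarrow> bool" where
  "zorich_base L hh \<longleftrightarrow>
     L \<ge> 1 \<and>
     (\<forall>a\<in>sqQ. \<forall>b\<in>sqQ. dist a b / L \<le> dist (hh a) (hh b) \<and> dist (hh a) (hh b) \<le> L * dist a b) \<and>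
     hh ` sqQ = upper_hemisphere \<and>
     hh ` frontier sqQ = equator \<and>
     sense_preserving_to_sphere hh \<and>
     (\<forall>t\<in>{-1..1}. hh (pt2 t t) $ 1 = hh (pt2 t t) $ 2) \<and>
     (\<forall>t\<in>{-1..1}. hh (pt2 t (-t)) $ 1 = - hh (pt2 t (-t)) $ 2)"

text \<open>Beam index: x lies in the beam [(2k-1)lam, (2k+1)lam] with k = round (x/(2 lam)),
  and the folding of x into [-lam,lam] obtained by the k repeated reflections across
  the lines (2j+1)lam.\<close>
definition beam_index :: "real \<Rightarrow> real \<Rightarrow> int" where
  "beam_index lam t = round (t / (2 * lam))"

definition fold_coord :: "real \<Rightarrow> real \<Rightarrow> real" where
  "fold_coord lam t = (-1) ^ nat \<bar>beam_index lam t\<bar> * (t - 2 * of_int (beam_index lam t) * lam)"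

text \<open>The Zorich map Z_nu: on the beam lam Q x R it is nu e^{x3} h(x1,x2) with
  h(x1,x2) = lam hh(x1/lam, x2/lam); it is extended by reflections (each reflection in the
  domain corresponds to the reflection x3 -> -x3 in the range).\<close>
definition zorich :: "(real^2 \<Rightarrow> real^3) \<Rightarrow> real \<Rightarrow> real \<Rightarrow> real^3 \<Rightarrow> real^3" where
  "zorich hh lam nu x =
     (let k1 = beam_index lam (x$1); k2 = beam_index lam (x$2);
          v = (nu * exp (x$3) * lam) *\<^sub>R
                hh (pt2 (fold_coord lam (x$1) / lam) (fold_coord lam (x$2) / lam))
      in (\<chi> i. if i = 3 then (-1) ^ nat \<bar>k1 + k2\<bar> * v $ 3 else v $ i))"

definition escaping_set :: "(real^3 \<Rightarrow> real^3) \<Rightarrow> (real^3) set" where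
  "escaping_set f = {x. filterlim (\<lambda>n. norm ((f ^^ n) x)) at_top sequentially}"

end

theory Submission
  imports Defs
begin

text \<open>
  Write \<open>f\<close> for the Zorich map, \<open>X\<close> for the \<open>x\<^sub>3\<close>-axis and \<open>I\<close> for the escaping set. The planes
  \<open>x\<^sub>1 + x\<^sub>2 \<in> 2\<lambda>\<int>\<close> and \<open>x\<^sub>1 - x\<^sub>2 \<in> 2\<lambda>\<int>\<close> cut space into beams with square cross section; by the
  diagonal symmetry of the hemisphere map, \<open>f\<close> sends each of them bijectively onto one of the four
  wedges bounded by \<open>x\<^sub>1 = \<plusminus>x\<^sub>2\<close>, minus the origin, and the inverse branches contract like
  \<open>const / |y|\<close>. Each beam has two opposite vertical edges, mapped to the upper and the lower half
  of \<open>X\<close>, and the beams adjacent to \<open>X\<close> lie inside a wedge. As \<open>\<nu>\<lambda> \<ge> 1\<close>, \<open>X\<close> escapes, and so do all its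
  preimages. As for the exponential map, the iterated preimages of the second edge of a beam
  adjacent to \<open>X\<close> are curves in \<open>I\<close> that accumulate at every point of \<open>X\<close> and of that edge.
  Hence a relatively clopen part of \<open>I\<close> inside a wedge that meets \<open>X\<close> contains all vertical edges
  in the wedge, then by induction all iterated preimages of \<open>X\<close>, and these are dense in \<open>I\<close>
  by the contraction along escaping orbits. The orbit \<open>P\<close> of the omitted value \<open>0\<close> is
  removed from \<open>I\<close> throughout, so that clopen sets can be pulled back by inverse branches.
\<close>

section \<open>Tilings by expanding branches\<close>

lemma escaping_set_image_iff: "f x \<in> escaping_set f \<longleftrightarrow> x \<in> escaping_set f"
proof -
  have "(f ^^ n) (f x) = (f ^^ Suc n) x" for n
    by (simp add: funpow_swap1)
  then show ?thesis
    unfolding escaping_set_def mem_Collect_eq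
    using filterlim_sequentially_Suc[of "\<lambda>n. norm ((f ^^ n) x)" at_top] by simp
qed

lemma clopen_contains_connected:
  assumes "openin (top_of_set Y) U" "closedin (top_of_set Y) U"
    and "connected S" "S \<subseteq> Y" "S \<inter> U \<noteq> {}"
  shows "S \<subseteq> U"
proof -
  obtain A B where "open A" "U = Y \<inter> A" "closed B" "U = Y \<inter> B"
    using assms(1,2) unfolding openin_open closedin_closed by blast
  then have "S \<inter> U = S \<inter> A" "S \<inter> U = S \<inter> B" using assms(4) by auto
  then have "openin (top_of_set S) (S \<inter> U)" "closedin (top_of_set S) (S \<inter> U)"
    using \<open>open A\<close> \<open>closed B\<close> openin_open_Int closedin_closed_Int by metis+
  then show ?thesis
    using assms(3,5) unfolding connected_clopen by blast
qed

text \<open>The sets \<open>W i\<close> model the wedges, \<open>tile d\<close> the beams,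
  \<open>line d\<close> and \<open>line' d\<close> the two edges of a beam lying over
  \<open>X\<close>, and \<open>P\<close> a forward invariant set containing 0. The estimate
  \<open>expand\<close> is asked only for images closer than half the norm, because an inverse
  branch loses control near the omitted value 0. The assumption \<open>chain\<close> replaces the
  grid geometry: a property that passes between the two edges of every tile in a wedge spreads from
  \<open>X\<close> to the edges there.\<close>

locale expanding_tiling =
  fixes f :: "real^3 \<Rightarrow> real^3"
    and W :: "'i \<Rightarrow> (real^3) set"
    and tile :: "'d \<Rightarrow> (real^3) set"
    and target :: "'d \<Rightarrow> 'i"
    and base :: "'i \<Rightarrow> 'd"
    and line line' :: "'d \<Rightarrow> (real^3) set"
    and X P :: "(real^3) set"
    and C M :: real
  assumes bij: "bij_betw f (tile d) (W (target d) - {0})"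
    and C_pos: "0 < C"
    and expand: "\<lbrakk>x \<in> tile d; y \<in> tile d; dist (f x) (f y) \<le> norm (f x) / 2\<rbrakk>
                   \<Longrightarrow> dist x y \<le> C * dist (f x) (f y) / norm (f x)"
    and cover: "x \<in> W i \<Longrightarrow> \<exists>d. x \<in> tile d \<and> tile d \<subseteq> W i"
    and W_cover: "(\<Union>i. W i) = UNIV"
    and near: "x \<in> tile d \<Longrightarrow> \<exists>y\<in>line' d. dist x y \<le> M"
    and lines: "line d \<union> line' d = {x \<in> tile d. f x \<in> X}"
    and connected_line: "connected (line d)" "connected (line' d)"
    and tile_base: "tile (base i) \<subseteq> W i"
    and line_base: "line (base i) = X"
    and line'_X: "line' d \<inter> X = {}"
    and line_X: "\<lbrakk>tile d \<subseteq> W i; d \<noteq> base i\<rbrakk> \<Longrightarrow> line d \<inter> X = {}"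
    and X_escapes: "X \<subseteq> escaping_set f"
    and f_X: "f ` X \<subseteq> X"
    and P_X: "P \<subseteq> X"
    and f_P: "f ` P \<subseteq> P"
    and zero_P: "0 \<in> P"
    and line_hits: "\<exists>x\<in>line d. f x \<notin> P"  "\<exists>x\<in>line' d. f x \<notin> P"
    and X_closure: "X \<subseteq> closure (X - P)"
    and chain: "\<lbrakk>S X; \<And>d. tile d \<subseteq> W i \<Longrightarrow> S (line d) \<longleftrightarrow> S (line' d); tile d \<subseteq> W i\<rbrakk> \<Longrightarrow> S (line d)"
begin

abbreviation I :: "(real^3) set" where "I \<equiv> escaping_set f"

section \<open>Inverse branches and their contraction\<close>

abbreviation branch :: "'d \<Rightarrow> real^3 \<Rightarrow> real^3" where
  "branch d \<equiv> inv_into (tile d) f"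

lemma branch:
  assumes "y \<in> W (target d)" "y \<noteq> 0"
  shows "branch d y \<in> tile d" "f (branch d y) = y"
  using assms bij[of d] by (auto simp: bij_betw_def intro!: inv_into_into f_inv_into_f)

lemma branch_f: "x \<in> tile d \<Longrightarrow> branch d (f x) = x"
  using bij[of d] by (auto simp: bij_betw_def)

lemma f_tile: "x \<in> tile d \<Longrightarrow> f x \<in> W (target d)" "x \<in> tile d \<Longrightarrow> f x \<noteq> 0"
  using bij[of d] by (auto simp: bij_betw_def)

lemma dist_branch:
  assumes "y \<in> W (target d)" "z \<in> W (target d)" "y \<noteq> 0" "dist y z < norm y / 2"
  shows "dist (branch d y) (branch d z) \<le> C * dist y z / norm y"
proof -
  have "z \<noteq> 0" using assms(3,4) by auto
  then show ?thesis
    using expand[of "branch d y" d "branch d z"] branch[of y d] branch[of z d] assms by auto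
qed

lemma continuous_branch: "continuous_on (W (target d) - {0}) (branch d)"
  unfolding continuous_on_iff
proof (intro ballI allI impI)
  fix y and e :: real assume y: "y \<in> W (target d) - {0}" and e: "0 < e"
  let ?\<delta> = "min (norm y / 2) (e * norm y / C)"
  have "dist (branch d z) (branch d y) < e"
    if z: "z \<in> W (target d) - {0}" "dist z y < ?\<delta>" for z
  proof -
    have "dist (branch d y) (branch d z) \<le> C * dist y z / norm y"
      using y z by (intro dist_branch) (auto simp: dist_commute)
    also have "\<dots> < e"
      using z y C_pos by (simp add: field_simps dist_commute)
    finally show ?thesis by (simp add: dist_commute)
  qed
  moreover have "0 < ?\<delta>" using y e C_pos by simp
  ultimately show "\<exists>\<delta>>0. \<forall>z\<in>W (target d) - {0}. dist z y < \<delta> \<longrightarrow> dist (branch d z) (branch d y) < e"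
    by blast
qed

lemma X_W: "X \<subseteq> W i"
  using line_base[of i] lines[of "base i"] tile_base[of i] by blast

lemma lines_tile: "line d \<subseteq> tile d" "line' d \<subseteq> tile d"
  using lines[of d] by auto

lemma f_lines: "x \<in> line d \<Longrightarrow> f x \<in> X" "x \<in> line' d \<Longrightarrow> f x \<in> X"
  using lines[of d] by auto

lemma lines_escape: "line d \<subseteq> I" "line' d \<subseteq> I"
  using f_lines X_escapes escaping_set_image_iff[of f] by blast+

text \<open>Along an escaping orbit the inverse branches eventually halve distances, so a point
  near the \<open>n\<close>-th iterate pulls back to a point close to the start.\<close>
lemma pullback_near:
  assumes z: "z \<in> I" and orbit: "\<And>k. (f ^^ k) z \<in> tile (D k)"
    and nest: "\<And>k. tile (D (Suc k)) \<subseteq> W (target (D k))"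
    and q: "\<And>n. q n \<in> tile (D n)" "\<And>n. dist ((f ^^ n) z) (q n) \<le> M"
    and "0 < e"
  shows "\<forall>\<^sub>F n in sequentially. \<exists>w. dist z w < e \<and> (f ^^ n) w = q n \<and> (\<forall>i\<le>n. (f ^^ i) w \<in> tile (D i))"
proof -
  \<comment> \<open>\<open>Q k n w\<close> says that \<open>w\<close> is a legitimate substitute for
    the \<open>k\<close>-th iterate of \<open>z\<close>: it reaches \<open>q n\<close> after the
    remaining \<open>n - k\<close> steps and visits the tiles \<open>D k\<close>, ...,
    \<open>D n\<close> on the way.\<close>
  define Q where "Q k n w \<longleftrightarrow> (f ^^ (n - k)) w = q n \<and> (\<forall>i\<le>n-k. (f ^^ i) w \<in> tile (D (k + i)))" for k n w
  have M0: "0 \<le> M" using q(2)[of 0] zero_le_dist order_trans by blast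
  have zW: "(f ^^ Suc k) z \<in> W (target (D k))" "(f ^^ Suc k) z \<noteq> 0" 
    "branch (D k) ((f ^^ Suc k) z) = (f ^^ k) z" for k
    using f_tile[OF orbit[of k]] branch_f[OF orbit[of k]] by auto
  have pull: "Q k n (branch (D k) w)" if "Q (Suc k) n w" "k < n" "w \<noteq> 0" for k n w
  proof -
    have "w \<in> tile (D (Suc k))" using that(1) unfolding Q_def by (metis add_0_right funpow_0 le0)
    then have b: "branch (D k) w \<in> tile (D k)" "f (branch (D k) w) = w"
      using branch nest that(3) by blast+
    have n: "n - k = Suc (n - Suc k)" using that(2) by simp
    have "(f ^^ i) (branch (D k) w) \<in> tile (D (k + i))" if "i \<le> n - k" for i
    proof (cases i)
      case 0 then show ?thesis using b by simp
    next
      case (Suc j)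
      then have "j \<le> n - Suc k" using that n by simp
      then have "(f ^^ j) w \<in> tile (D (Suc k + j))" using \<open>Q (Suc k) n w\<close> unfolding Q_def by blast
      then show ?thesis using Suc b by (simp add: funpow_swap1)
    qed
    moreover have "(f ^^ (n - k)) (branch (D k) w) = q n"
      using that(1) b n unfolding Q_def by (simp add: funpow_swap1)
    ultimately show ?thesis unfolding Q_def by blast
  qed
  have "\<forall>\<^sub>F n in sequentially. 2 * M + 2 * C + 1 \<le> norm ((f ^^ n) z)"
    using z unfolding escaping_set_def by (simp add: filterlim_at_top)
  \<comment> \<open>The part \<open>2 * M + 1\<close> of the threshold makes every distance up to
    \<open>M\<close> smaller than half the norm, as \<open>dist_branch\<close> demands; the part
    \<open>2 * C\<close> makes the contraction factor at most 1/2.\<close>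
  then obtain N where N: "\<And>n. n \<ge> N \<Longrightarrow> 2 * M + 2 * C + 1 \<le> norm ((f ^^ n) z)"
    unfolding eventually_sequentially by auto
  \<comment> \<open>Pull \<open>q n\<close> back one branch at a time, from time \<open>n\<close>
    down to time \<open>k\<close>; each branch halves the distance.\<close>
  have far: "\<exists>w. Q k n w \<and> dist ((f ^^ k) z) w \<le> M / 2 ^ (n - k)" if "N \<le> k" "k \<le> n" for k n
    using that(2,1)
  proof (induction rule: inc_induct)
    case base
    then show ?case using q unfolding Q_def by (intro exI[of _ "q n"]) auto
  next
    case (step k)
    then obtain w where w: "Q (Suc k) n w" "dist ((f ^^ Suc k) z) w \<le> M / 2 ^ (n - Suc k)" by auto
    let ?y = "(f ^^ Suc k) z"
    have "M / 2 ^ (n - Suc k) \<le> M" using M0 by (simp add: divide_le_eq mult_le_cancel_left1)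
    then have d: "dist ?y w < norm ?y / 2" and big: "2 * C \<le> norm ?y"
      using N[of "Suc k"] step.prems w(2) C_pos M0 by auto
    then have "w \<noteq> 0" using zW[of k] by auto
    have wt: "w \<in> tile (D (Suc k))" using w(1) unfolding Q_def by (metis add_0_right funpow_0 le0)
    have "dist ((f ^^ k) z) (branch (D k) w) \<le> C * dist ?y w / norm ?y"
      using dist_branch[OF zW(1) _ zW(2) d] wt nest zW(3)[of k] by auto
    also have "\<dots> \<le> dist ?y w / 2"
      using big zW(2)[of k] mult_right_mono[OF big zero_le_dist[of ?y w]]
      by (simp add: field_simps del: funpow.simps)
    also have "\<dots> \<le> M / 2 ^ (n - Suc k) / 2" using w(2) by simp
    also have "\<dots> = M / 2 ^ (n - k)"
      using step.hyps by (simp add: Suc_diff_Suc[symmetric] field_simps)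
    finally show ?case using \<open>w \<noteq> 0\<close> w(1) step.hyps pull by blast
  qed
  \<comment> \<open>Below time \<open>N\<close> the iterates may be small and nothing contracts, but
    only finitely many branches remain, and each is continuous at the orbit of
    \<open>z\<close>.\<close>
  have "\<forall>e>0. \<forall>\<^sub>F n in sequentially. \<exists>w. dist ((f ^^ k) z) w < e \<and> Q k n w" if "k \<le> N" for k
    using that
  proof (induction rule: inc_induct)
    case base
    show ?case
    proof (intro allI impI)
      fix e :: real assume "0 < e"
      have "(\<lambda>n. M / 2 ^ (n - N)) \<longlonglongrightarrow> 0"
        by (rule LIMSEQ_offset[of _ N]) (simp add: LIMSEQ_divide_realpow_zero)
      then have "\<forall>\<^sub>F n in sequentially. M / 2 ^ (n - N) < e"
        using \<open>0 < e\<close> by (rule order_tendstoD)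
      then show "\<forall>\<^sub>F n in sequentially. \<exists>w. dist ((f ^^ N) z) w < e \<and> Q N n w"
        using eventually_ge_at_top[of N] by eventually_elim (use far in force)
    qed
  next
    case (step k)
    show ?case
    proof (intro allI impI)
      fix e :: real assume "0 < e"
      let ?y = "(f ^^ Suc k) z"
      let ?\<delta> = "min (norm ?y / 2) (e * norm ?y / C)"
      have "0 < ?\<delta>" using \<open>0 < e\<close> C_pos zW(2)[of k] by simp
      then have "\<forall>\<^sub>F n in sequentially. \<exists>w. dist ?y w < ?\<delta> \<and> Q (Suc k) n w"
        using step.IH by blast
      then show "\<forall>\<^sub>F n in sequentially. \<exists>w. dist ((f ^^ k) z) w < e \<and> Q k n w"
        using eventually_gt_at_top[of k]
      proof eventually_elim
        case (elim n)
        then obtain w where w: "dist ?y w < ?\<delta>" "Q (Suc k) n w" by blast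
        have wt: "w \<in> tile (D (Suc k))" using w(2) unfolding Q_def by (metis add_0_right funpow_0 le0)
        have "w \<noteq> 0" using w(1) zW(2)[of k] by auto
        have "dist ((f ^^ k) z) (branch (D k) w) \<le> C * dist ?y w / norm ?y"
          using dist_branch[OF zW(1)[of k] _ zW(2)[of k], of w] wt nest zW(3)[of k] w(1) by auto
        also have "\<dots> < e" using w(1) zW(2)[of k] C_pos by (simp add: field_simps del: funpow.simps)
        finally show ?case using \<open>w \<noteq> 0\<close> w(2) elim(2) pull by blast
      qed
    qed
  qed
  from this[of 0] show ?thesis using \<open>0 < e\<close> unfolding Q_def by simp
qed

section \<open>Curves of escaping points that accumulate on the axis\<close>

fun gam :: "nat \<Rightarrow> 'i \<Rightarrow> (real^3) set" where
  "gam 0 i = line' (base i)"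
| "gam (Suc n) i = branch (base i) ` gam n (target (base i))"

text \<open>The set \<open>gam n i\<close> is a branch of the \<open>n\<close>-th preimage of the
  second edge of a base tile, taken along the itinerary that the axis itself follows. It escapes
  because \<open>I\<close> is completely invariant, and it avoids \<open>X\<close> because the
  second edge does and \<open>X\<close> is forward invariant. In particular it avoids 0, so the next
  branch is continuous on it.\<close>

lemma gam:
  "gam n i \<subseteq> tile (base i) \<inter> (I - X) \<and> connected (gam n i)"
proof (induction n arbitrary: i)
  case 0
  have "line' (base i) \<subseteq> tile (base i) \<inter> (I - X)"
    using lines_tile[of "base i"] lines_escape[of "base i"] line'_X[of "base i"] by blast
  then show ?case using connected_line by simp
next
  case (Suc n)
  let ?j = "target (base i)"
  have sub: "gam n ?j \<subseteq> W ?j - {0}" using Suc[of ?j] tile_base[of ?j] zero_P P_X by blast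
  have "branch (base i) y \<in> tile (base i) \<inter> (I - X)" if "y \<in> gam n ?j" for y
  proof -
    have b: "branch (base i) y \<in> tile (base i)" "f (branch (base i) y) = y"
      using sub that branch[of y "base i"] by auto
    then show ?thesis using Suc[of ?j] that escaping_set_image_iff[of f "branch (base i) y"] f_X by (auto dest!: subsetD)
  qed
  then show ?case
    using connected_continuous_image[OF continuous_on_subset[OF continuous_branch[of "base i"] sub]] Suc[of ?j] by auto
qed

text \<open>The itinerary determines the branches, since \<open>f\<close> is injective on each tile.
  In this form membership can be read off from the points supplied by
  \<open>pullback_near\<close>.\<close>

lemma gam_intro:
  assumes "(f ^^ n) w \<in> line' (base (((\<lambda>i. target (base i)) ^^ n) i))"
    and "\<And>k. k \<le> n \<Longrightarrow> (f ^^ k) w \<in> tile (base (((\<lambda>i. target (base i)) ^^ k) i))"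
  shows "w \<in> gam n i"
  using assms
proof (induction n arbitrary: i w)
  case (Suc n)
  have "f w \<in> gam n (target (base i))"
  proof (rule Suc.IH)
    show "(f ^^ n) (f w) \<in> line' (base (((\<lambda>i. target (base i)) ^^ n) (target (base i))))"
      using Suc.prems(1) by (simp only: funpow_Suc_right o_apply)
    show "(f ^^ k) (f w) \<in> tile (base (((\<lambda>i. target (base i)) ^^ k) (target (base i))))" if "k \<le> n" for k
      using Suc.prems(2)[of "Suc k"] that by (simp only: funpow_Suc_right o_apply Suc_le_mono)
  qed
  moreover have "w \<in> tile (base i)" using Suc.prems(2)[of 0] by simp
  ultimately show ?case using branch_f[of w "base i"] by force
qed simp

text \<open>From the first iterate on, the orbit of \<open>z\<close> stays in \<open>X\<close>,
  hence in every base tile, so \<open>z\<close> has the itinerary of the curves. Each iterate is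
  within \<open>M\<close> of the second edge of its base tile, and \<open>pullback_near\<close>
  carries that edge back to \<open>z\<close>.\<close>

lemma gam_near:
  assumes "z \<in> X \<union> line' (base i)" "0 < e"
  shows "\<forall>\<^sub>F n in sequentially. gam n i \<inter> ball z e \<noteq> {}"
proof -
  define \<sigma> where "\<sigma> k = ((\<lambda>i. target (base i)) ^^ k) i" for k
  have X: "x \<in> tile (base j)" if "x \<in> X" for x j
    using that line_base lines_tile by blast
  have fz: "(f ^^ Suc k) z \<in> X" for k
    by (induction k) (use assms f_lines f_X in auto)
  have orbit: "(f ^^ k) z \<in> tile (base (\<sigma> k))" for k
  proof (cases k)
    case 0 then show ?thesis using assms X lines_tile[of "base i"] by (auto simp: \<sigma>_def)
  next
    case (Suc l) then show ?thesis using fz X by simp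
  qed
  obtain q where q: "\<And>n. q n \<in> line' (base (\<sigma> n)) \<and> dist ((f ^^ n) z) (q n) \<le> M"
    using near[OF orbit] by metis
  have "\<forall>\<^sub>F n in sequentially. \<exists>w. dist z w < e \<and> (f ^^ n) w = q n \<and> (\<forall>i\<le>n. (f ^^ i) w \<in> tile (base (\<sigma> i)))"
  proof (rule pullback_near[OF _ orbit])
    show "z \<in> I" using assms X_escapes lines_escape by blast
    show "tile (base (\<sigma> (Suc k))) \<subseteq> W (target (base (\<sigma> k)))" for k
      using tile_base by (simp add: \<sigma>_def)
    show "q n \<in> tile (base (\<sigma> n))" "dist ((f ^^ n) z) (q n) \<le> M" for n
      using q lines_tile by blast+
  qed fact
  then show ?thesis
  proof eventually_elim
    case (elim n)
    then obtain w where w: "dist z w < e" "(f ^^ n) w = q n" "\<forall>i\<le>n. (f ^^ i) w \<in> tile (base (\<sigma> i))" by blast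
    have "w \<in> gam n i"
      using w q by (intro gam_intro) (auto simp: \<sigma>_def)
    then show ?case using w(1) by auto
  qed
qed

section \<open>Relatively clopen parts of the escaping set in a wedge\<close>

definition Y :: "'i \<Rightarrow> (real^3) set" where "Y i = W i \<inter> (I - P)"

text \<open>The curves \<open>gam n i\<close> accumulate both on the axis and on the second line of the base tile.\<close>
lemma clopen_base:
  assumes U: "openin (top_of_set (Y i)) U" "closedin (top_of_set (Y i)) U"
    and "U \<inter> (X \<union> line' (base i)) \<noteq> {}"
  shows "(X - P) \<union> line' (base i) \<subseteq> U"
proof
  obtain z where z: "z \<in> U" "z \<in> X \<union> line' (base i)" using assms(3) by blast
  \<comment> \<open>Openness gives a ball about \<open>z\<close> inside \<open>U\<close>; all late
    curves meet it and, being connected, lie in \<open>U\<close>. Closedness of \<open>U\<close>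
    then collects their accumulation points.\<close>
  obtain e where e: "0 < e" "ball z e \<inter> Y i \<subseteq> U"
    using U(1) z(1) by (metis openin_contains_ball)
  have gY: "gam n i \<subseteq> Y i" for n
    using gam[of n i] tile_base[of i] P_X unfolding Y_def by blast
  have "\<forall>\<^sub>F n in sequentially. gam n i \<subseteq> U"
    using gam_near[OF z(2) e(1)]
  proof eventually_elim
    case (elim n)
    then have "gam n i \<inter> U \<noteq> {}" using e(2) gY[of n] by blast
    then show ?case using clopen_contains_connected[OF U _ gY] gam by blast
  qed
  note gU = this
  fix x assume x: "x \<in> (X - P) \<union> line' (base i)"
  have "\<exists>y\<in>U. dist y x < e" if "0 < e" for e
  proof -
    have "\<forall>\<^sub>F n in sequentially. gam n i \<subseteq> U \<and> gam n i \<inter> ball x e \<noteq> {}"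
      using gU gam_near[of x i e] x that by (intro eventually_conj) auto
    then obtain n where "gam n i \<subseteq> U" "gam n i \<inter> ball x e \<noteq> {}"
      using eventually_happens by fastforce
    then show ?thesis by (auto simp: dist_commute)
  qed
  then have "x \<in> closure U" by (simp add: closure_approachable)
  moreover have "x \<in> Y i"
    using x X_W X_escapes lines_escape lines_tile[of "base i"] tile_base[of i] line'_X P_X unfolding Y_def by blast
  ultimately show "x \<in> U" using U(2) by (metis closedin_limpt closure_def UnE mem_Collect_eq)
qed

text \<open>\<open>branch d\<close> maps \<open>Y (target d)\<close> continuously into
  \<open>Y i\<close>: the point 0 has been removed from its domain, and a value in \<open>P\<close>
  is impossible since \<open>f\<close> maps \<open>P\<close> into itself.\<close>

lemma clopen_pullback:
  assumes U: "openin (top_of_set (Y i)) U" "closedin (top_of_set (Y i)) U"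
    and "tile d \<subseteq> W i"
  defines "V \<equiv> {y \<in> Y (target d). branch d y \<in> U}"
  shows "openin (top_of_set (Y (target d))) V" "closedin (top_of_set (Y (target d))) V"
proof -
  have sub: "Y (target d) \<subseteq> W (target d) - {0}" unfolding Y_def using zero_P by blast
  have "branch d \<in> Y (target d) \<rightarrow> Y i"
  proof
    fix y assume y: "y \<in> Y (target d)"
    then have b: "branch d y \<in> tile d" "f (branch d y) = y" using sub branch[of y d] by auto
    then have "branch d y \<in> I" "branch d y \<notin> P"
      using y escaping_set_image_iff[of f "branch d y"] f_P unfolding Y_def by auto
    then show "branch d y \<in> Y i" using b assms(3) unfolding Y_def by blast
  qed
  note cont = continuous_on_subset[OF continuous_branch sub] this
  have "V = Y (target d) \<inter> branch d -` U" unfolding V_def by auto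
  then show "openin (top_of_set (Y (target d))) V" "closedin (top_of_set (Y (target d))) V"
    using continuous_openin_preimage[OF cont U(1)] continuous_closedin_preimage_gen[OF cont U(2)] by auto
qed

text \<open>Away from the base tile, apply \<open>clopen_base\<close> to the pullback of
  \<open>U\<close>. Both edges correspond to parts of \<open>X\<close> there, and a single point of
  \<open>X\<close> in the pullback forces all of \<open>X - P\<close> into it, hence points of the
  other edge into \<open>U\<close>.\<close>

lemma clopen_tile:
  assumes U: "openin (top_of_set (Y i)) U" "closedin (top_of_set (Y i)) U"
    and d: "tile d \<subseteq> W i" and meets: "U \<inter> (line d \<union> line' d) \<noteq> {}"
  shows "line d \<union> line' d - P \<subseteq> U"
proof (cases "d = base i")
  case True
  then show ?thesis using clopen_base[OF U] meets line_base by auto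
next
  case False
  let ?V = "{y \<in> Y (target d). branch d y \<in> U}"
  note V = clopen_pullback[OF U d]
  have disj: "line d \<inter> X = {}" "line' d \<inter> X = {}" using line_X[OF d False] line'_X by auto
  then have lY: "line d \<subseteq> Y i" "line' d \<subseteq> Y i"
    using lines_tile[of d] lines_escape[of d] d P_X unfolding Y_def by blast+
  have sub: "m \<subseteq> U" if "m \<in> {line d, line' d}" "m \<inter> U \<noteq> {}" for m
    using that lY connected_line clopen_contains_connected[OF U] by blast
  have img: "f x \<in> Y (target d) \<and> f x \<in> X \<and> branch d (f x) = x"
    if "x \<in> line d \<union> line' d" "f x \<notin> P" for x
    using that f_lines f_tile[of x d] lines_tile[of d] X_escapes branch_f unfolding Y_def by blast
  obtain m where m: "m \<in> {line d, line' d}" "m \<subseteq> U" using meets sub by blast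
  \<comment> \<open>The point must satisfy \<open>f x \<notin> P\<close>, because the pullback is a
    subset of \<open>Y (target d)\<close>; this is what \<open>line_hits\<close> provides.\<close>
  obtain x where "x \<in> m" "f x \<notin> P" using m(1) line_hits[of d] by (metis insertE singletonD)
  then have "f x \<in> ?V \<inter> X" using img[of x] m by auto
  then have XV: "X - P \<subseteq> ?V" using clopen_base[OF V] by blast
  have "m \<inter> U \<noteq> {}" if m: "m \<in> {line d, line' d}" for m
  proof -
    obtain x where "x \<in> m" "f x \<notin> P" using m line_hits[of d] by (metis insertE singletonD)
    then have "f x \<in> ?V" using img[of x] XV m by blast
    then show ?thesis using \<open>x \<in> m\<close> \<open>f x \<notin> P\<close> img[of x] m by auto
  qed
  then show ?thesis using sub by blast
qed

text \<open>By \<open>clopen_tile\<close> the property of meeting \<open>U\<close> passes between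
  the two edges of any tile in the wedge, so \<open>chain\<close> spreads it from
  \<open>X\<close>.\<close>

lemma clopen_lines:
  assumes U: "openin (top_of_set (Y i)) U" "closedin (top_of_set (Y i)) U"
    and meets: "U \<inter> X \<noteq> {}" and d: "tile d \<subseteq> W i"
  shows "line d \<union> line' d - P \<subseteq> U"
proof -
  have "U \<inter> line d \<noteq> {}"
  proof (rule chain[of "\<lambda>m. U \<inter> m \<noteq> {}", OF meets _ d])
    fix d assume d: "tile d \<subseteq> W i"
    have "line d - P \<noteq> {}" "line' d - P \<noteq> {}" using line_hits[of d] f_P by blast+
    then show "(U \<inter> line d \<noteq> {}) \<longleftrightarrow> (U \<inter> line' d \<noteq> {})"
      using clopen_tile[OF U d] by blast
  qed
  then show ?thesis using clopen_tile[OF U d] by blast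
qed

text \<open>Induction on \<open>n\<close> with \<open>U\<close> and the wedge varying. The pullback
  of \<open>U\<close> along the tile of \<open>w\<close> is again clopen, and it again meets
  \<open>X\<close> because \<open>U\<close> contains the edges of that tile up to \<open>P\<close>.
  So the induction hypothesis applies to \<open>f w\<close>.\<close>

lemma clopen_preimages:
  assumes "openin (top_of_set (Y i)) U" "closedin (top_of_set (Y i)) U"
    and "U \<inter> X \<noteq> {}" and "w \<in> W i" "w \<notin> P" "(f ^^ n) w \<in> X"
  shows "w \<in> U"
  using assms
proof (induction n arbitrary: i U w)
  case 0
  have "w \<in> X - P" using 0 by simp
  then show ?case using clopen_base[OF 0(1,2)] 0(3) by blast
next
  case (Suc n)
  note U = Suc.prems(1,2)
  obtain d where d: "w \<in> tile d" "tile d \<subseteq> W i" using cover[OF Suc.prems(4)] by blast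
  note l = clopen_lines[OF U Suc.prems(3) d(2)]
  show ?case
  proof (cases "f w \<in> P")
    \<comment> \<open>Now \<open>f w\<close> lies outside \<open>Y (target d)\<close>, so the
      pullback says nothing about it. But \<open>P\<close> is part of \<open>X\<close>, which puts
      \<open>w\<close> on an edge of its tile.\<close>
    case True
    then have "w \<in> line d \<union> line' d" using lines d(1) P_X by blast
    then show ?thesis using l Suc.prems(5) by blast
  next
    case False
    let ?V = "{y \<in> Y (target d). branch d y \<in> U}"
    obtain x where x: "x \<in> line d" "f x \<notin> P" using line_hits by blast
    then have "x \<in> U" using l f_P by blast
    then have "f x \<in> ?V \<inter> X"
      using x f_lines[of x d] f_tile[of x d] lines_tile[of d] X_escapes branch_f unfolding Y_def by auto
    moreover have "f w \<in> W (target d)" "(f ^^ n) (f w) \<in> X"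
      using f_tile d Suc.prems(6) by (auto simp: funpow_swap1)
    ultimately have "f w \<in> ?V"
      using Suc.IH[OF clopen_pullback[OF U d(2)], of "f w"] False by blast
    then show ?thesis using branch_f[OF d(1)] by simp
  qed
qed

section \<open>Density of the preimages of the axis and connectedness\<close>

lemma preimages_dense:
  assumes "z \<in> W i \<inter> I" "0 < e"
  shows "\<exists>w n. w \<in> W i \<and> dist z w < e \<and> (f ^^ n) w \<in> X"
proof -
  obtain pick where pick: "\<And>x i. x \<in> W i \<Longrightarrow> x \<in> tile (pick x i) \<and> tile (pick x i) \<subseteq> W i"
    using cover by metis
  \<comment> \<open>The itinerary is chosen recursively so that each tile contains the current
    iterate and also fits into the wedge onto which the previous tile is mapped; both are needed to
    compose the branches.\<close>
  define D where "D = rec_nat (pick z i) (\<lambda>k d. pick ((f ^^ Suc k) z) (target d))"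
  have D0: "D 0 = pick z i" and DS: "D (Suc k) = pick ((f ^^ Suc k) z) (target (D k))" for k
    by (simp_all add: D_def)
  have orbit: "(f ^^ k) z \<in> tile (D k)" for k
  proof (induction k)
    case 0 then show ?case using pick[of z i] assms by (simp add: D0)
  next
    case (Suc k) then show ?case using pick f_tile by (simp add: DS)
  qed
  obtain q where q: "\<And>n. q n \<in> line' (D n) \<and> dist ((f ^^ n) z) (q n) \<le> M"
    using near[OF orbit] by metis
  have "\<forall>\<^sub>F n in sequentially. \<exists>w. dist z w < e \<and> (f ^^ n) w = q n \<and> (\<forall>i\<le>n. (f ^^ i) w \<in> tile (D i))"
  proof (rule pullback_near[OF _ orbit])
    show "z \<in> I" using assms by blast
    show "tile (D (Suc k)) \<subseteq> W (target (D k))" for k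
      using pick f_tile[OF orbit[of k]] by (simp add: DS)
    show "q n \<in> tile (D n)" "dist ((f ^^ n) z) (q n) \<le> M" for n
      using q lines_tile by blast+
  qed fact
  then obtain n w where w: "dist z w < e" "(f ^^ n) w = q n" "\<forall>i\<le>n. (f ^^ i) w \<in> tile (D i)"
    using eventually_happens by fastforce
  then have "w \<in> tile (D 0)" by (metis funpow_0 le0)
  then have "w \<in> W i" using pick[of z i] assms by (auto simp: D0)
  moreover have "(f ^^ Suc n) w \<in> X" using w(2) q[of n] f_lines(2)[of "q n"] by auto
  ultimately show ?thesis using w(1) by blast
qed

lemma connected_Y: "connected (Y i)"
proof -
  have XY: "X - P \<subseteq> Y i" using X_W X_escapes unfolding Y_def by blast
  have *: "U = Y i" if U: "openin (top_of_set (Y i)) U" "closedin (top_of_set (Y i)) U" "U \<inter> X \<noteq> {}" for U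
  proof
    show "U \<subseteq> Y i" using openin_imp_subset[OF U(1)] .
    show "Y i \<subseteq> U"
    proof (rule ccontr)
      assume "\<not> Y i \<subseteq> U"
      then obtain z where z: "z \<in> Y i - U" by blast
      have "openin (top_of_set (Y i)) (Y i - U)" using U(2) by (simp add: openin_diff)
      then obtain e where e: "0 < e" "ball z e \<inter> Y i \<subseteq> Y i - U"
        using z by (metis openin_contains_ball)
      obtain w n where w: "w \<in> W i" "dist z w < e" "(f ^^ n) w \<in> X"
        using preimages_dense[of z i e] z e(1) unfolding Y_def by blast
      show False
      proof (cases "w \<in> P")
        case True
        \<comment> \<open>A point of \<open>P\<close> does not belong to \<open>Y i\<close>, so
          \<open>w\<close> is replaced by a nearby point of \<open>X - P\<close>, to which
          \<open>clopen_preimages\<close> applies with no iteration at all.\<close>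
        then have "w \<in> closure (X - P)" using X_closure P_X by blast
        then obtain w' where w': "w' \<in> X - P" "dist w' w < e - dist z w"
          using w(2) unfolding closure_approachable by (metis diff_gt_0_iff_gt)
        then have "w' \<in> ball z e" using dist_triangle[of z w' w] by (simp add: dist_commute)
        moreover have "w' \<in> U" using clopen_preimages[OF U, of w' 0] w' X_W by auto
        ultimately show False using e(2) w' XY by blast
      next
        case False
        then have "w \<in> U" using clopen_preimages[OF U w(1) _ w(3)] by blast
        then show False using e(2) w(2) \<open>U \<subseteq> Y i\<close> by auto
      qed
    qed
  qed
  have "X - P \<noteq> {}" using X_closure zero_P P_X by (metis closure_empty empty_iff subsetD)
  then obtain x where x: "x \<in> X - P" by blast
  show ?thesis unfolding connected_clopen
  proof (intro allI impI)
    fix U assume U: "openin (top_of_set (Y i)) U \<and> closedin (top_of_set (Y i)) U"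
    show "U = {} \<or> U = Y i"
    proof (cases "x \<in> U")
      case True then show ?thesis using *[of U] U x by blast
    next
      case False
      have "Y i - U = Y i"
        using U x XY False by (intro *) (auto intro: openin_diff closedin_diff)
      then show ?thesis using U openin_imp_subset by blast
    qed
  qed
qed

text \<open>Putting \<open>P\<close> back adds only limit points of \<open>Y i\<close>, so each
  \<open>W i \<inter> I\<close> is connected. These pieces share the axis and cover
  \<open>I\<close>.\<close>

theorem connected_escaping: "connected I"
proof -
  have "connected (W i \<inter> I)" for i
  proof (rule connected_intermediate_closure[OF connected_Y[of i]])
    show "Y i \<subseteq> W i \<inter> I" unfolding Y_def by blast
    have "X - P \<subseteq> Y i" using X_W X_escapes unfolding Y_def by blast
    then have "P \<subseteq> closure (Y i)" using X_closure P_X closure_mono by blast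
    then show "W i \<inter> I \<subseteq> closure (Y i)" using closure_subset[of "Y i"] unfolding Y_def by blast
  qed
  moreover have "(\<Inter>i. W i \<inter> I) \<noteq> {}" using X_W zero_P P_X X_escapes by blast
  ultimately have "connected (\<Union>i. W i \<inter> I)" by (intro connected_Union) auto
  then show ?thesis using W_cover by (simp flip: Int_UN_distrib2 add: Int_commute)
qed

end

section \<open>The hemisphere map on diagonal triangles\<close>

definition sg :: "bool \<Rightarrow> real" where "sg b = (if b then 1 else - 1)"

lemma sg_simps [simp]: "sg b * sg b = 1" "\<bar>sg b\<bar> = 1" "sg b \<noteq> 0" "sg b * (sg b * r) = r" "(sg b)\<^sup>2 = 1"
  by (auto simp: sg_def)

lemma ex_sg_pos: "r \<noteq> 0 \<Longrightarrow> \<exists>b. 0 < sg b * r"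
  by (rule exI[of _ "0 < r"]) (auto simp: sg_def)

lemma sg_pos_unique: "0 < sg b * r \<Longrightarrow> 0 < sg c * r \<Longrightarrow> b = c"
  by (auto simp: sg_def split: if_splits)

text \<open>The two booleans are the signs of \<open>x1 + x2\<close> and \<open>x1 - x2\<close>, so
  in diagonal coordinates a wedge is a quadrant times a line.\<close>

definition wedge :: "bool \<times> bool \<Rightarrow> (real^3) set" where
  "wedge i = {y. 0 \<le> sg (fst i) * (y$1 + y$2) \<and> 0 \<le> sg (snd i) * (y$1 - y$2)}"

definition open_wedge :: "bool \<times> bool \<Rightarrow> (real^3) set" where
  "open_wedge i = {y. 0 < sg (fst i) * (y$1 + y$2) \<and> 0 < sg (snd i) * (y$1 - y$2)}"

definition tri :: "bool \<times> bool \<Rightarrow> (real^2) set" where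
  "tri i = {x \<in> sqQ. 0 \<le> sg (fst i) * (x$1 + x$2) \<and> 0 \<le> sg (snd i) * (x$1 - x$2)}"

definition open_tri :: "bool \<times> bool \<Rightarrow> (real^2) set" where
  "open_tri i = {x \<in> sqQ. 0 < sg (fst i) * (x$1 + x$2) \<and> 0 < sg (snd i) * (x$1 - x$2)}"

lemma open_wedge_unique: "y \<in> open_wedge i \<Longrightarrow> y \<in> open_wedge j \<Longrightarrow> i = j"
  unfolding open_wedge_def using sg_pos_unique by (auto intro!: prod_eqI)

lemma closed_wedge: "closed (wedge i)"
  unfolding wedge_def by (intro closed_Collect_conj closed_Collect_le continuous_intros)

lemma norm_vec3_sq: "(norm y)\<^sup>2 = (y$1)\<^sup>2 + (y$2)\<^sup>2 + (y$3)\<^sup>2" for y :: "real^3"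
  by (simp only: power2_norm_eq_inner) (simp add: inner_vec_def sum_3 power2_eq_square)

lemma norm_vec2_sq: "(norm y)\<^sup>2 = (y$1)\<^sup>2 + (y$2)\<^sup>2" for y :: "real^2"
  by (simp only: power2_norm_eq_inner) (simp add: inner_vec_def sum_2 power2_eq_square)

lemma pt2_simps [simp]: "pt2 a b $ 1 = a" "pt2 a b $ 2 = b"
  by (simp_all add: pt2_def)

lemma pt2_eqI: "x$1 = a \<Longrightarrow> x$2 = b \<Longrightarrow> x = pt2 a b"
  by (simp add: vec_eq_iff forall_2)

lemma sqQ_cbox: "sqQ = cbox (pt2 (-1) (-1)) (pt2 1 1)"
  by (auto simp: sqQ_def mem_box_cart forall_2)

lemma frontier_sqQ: "frontier sqQ = {x \<in> sqQ. \<bar>x$1\<bar> = 1 \<or> \<bar>x$2\<bar> = 1}"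
  unfolding sqQ_cbox frontier_cbox by (auto simp: mem_box_cart forall_2)

lemma convex_sqQ: "convex sqQ" and compact_sqQ: "compact sqQ"
  by (simp_all add: sqQ_cbox)

lemma convex_open_tri: "convex (open_tri i)"
proof -
  have "convex {x::real^2. 0 < a * (x$1 + x$2)}" "convex {x::real^2. 0 < a * (x$1 - x$2)}" for a
  proof -
    have "{x::real^2. 0 < a * (x$1 + x$2)} = {x. pt2 a a \<bullet> x > 0}"
      "{x::real^2. 0 < a * (x$1 - x$2)} = {x. pt2 a (-a) \<bullet> x > 0}"
      by (auto simp: inner_vec_def sum_2 algebra_simps)
    then show "convex {x::real^2. 0 < a * (x$1 + x$2)}" "convex {x::real^2. 0 < a * (x$1 - x$2)}"
      by (simp_all add: convex_halfspace_gt)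
  qed
  moreover have "open_tri i = sqQ \<inter> {x. 0 < sg (fst i) * (x$1 + x$2)} \<inter> {x. 0 < sg (snd i) * (x$1 - x$2)}"
    by (auto simp: open_tri_def)
  ultimately show ?thesis by (simp add: convex_Int convex_sqQ)
qed

text \<open>The point \<open>c\<close> is the midpoint of the side that the triangle shares with the
  square. Both defining inequalities are strict there, so moving any point slightly towards
  \<open>c\<close> makes them strict.\<close>

lemma tri_closure: "tri i \<subseteq> closure (open_tri i)"
proof
  fix x assume x: "x \<in> tri i"
  define c where "c = pt2 ((sg (fst i) + sg (snd i)) / 2) ((sg (fst i) - sg (snd i)) / 2)"
  have c: "c \<in> sqQ" "c$1 + c$2 = sg (fst i)" "c$1 - c$2 = sg (snd i)"
    by (simp_all add: c_def sqQ_def sg_def)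
  have mem: "x + u *\<^sub>R (c - x) \<in> open_tri i" if u: "0 < u" "u \<le> 1" for u :: real
  proof -
    have eq: "x + u *\<^sub>R (c - x) = (1 - u) *\<^sub>R x + u *\<^sub>R c" by (simp add: algebra_simps)
    have "x + u *\<^sub>R (c - x) \<in> sqQ"
      unfolding eq using x c(1) u by (intro convexD_alt[OF convex_sqQ]) (auto simp: tri_def)
    moreover have "sg (fst i) * ((x + u *\<^sub>R (c - x))$1 + (x + u *\<^sub>R (c - x))$2)
        = (1 - u) * (sg (fst i) * (x$1 + x$2)) + u * (sg (fst i) * (c$1 + c$2))"
      by (simp add: algebra_simps)
    moreover have "sg (snd i) * ((x + u *\<^sub>R (c - x))$1 - (x + u *\<^sub>R (c - x))$2)
        = (1 - u) * (sg (snd i) * (x$1 - x$2)) + u * (sg (snd i) * (c$1 - c$2))"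
      by (simp add: algebra_simps)
    moreover have "0 \<le> (1 - u) * (sg (fst i) * (x$1 + x$2))" "0 \<le> (1 - u) * (sg (snd i) * (x$1 - x$2))"
      using x u by (auto simp: tri_def)
    ultimately show ?thesis using u(1) c unfolding open_tri_def by (simp add: add_nonneg_pos)
  qed
  have "x + (1 / real (Suc n)) *\<^sub>R (c - x) \<in> open_tri i" for n
    by (rule mem) auto
  moreover have "(\<lambda>n. x + (1 / real (Suc n)) *\<^sub>R (c - x)) \<longlonglongrightarrow> x + 0 *\<^sub>R (c - x)"
    using LIMSEQ_inverse_real_of_nat by (intro tendsto_intros) (simp add: inverse_eq_divide)
  then have "(\<lambda>n. x + (1 / real (Suc n)) *\<^sub>R (c - x)) \<longlonglongrightarrow> x" by simp
  ultimately show "x \<in> closure (open_tri i)"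
    unfolding closure_sequential by (intro exI[of _ "\<lambda>n. x + (1 / real (Suc n)) *\<^sub>R (c - x)"]) blast
qed

text \<open>This is the horizontal unit vector along the bisector of the wedge.\<close>

definition wedge_point :: "bool \<times> bool \<Rightarrow> real^3" where
  "wedge_point i = (\<chi> k. if k = 1 then (sg (fst i) + sg (snd i)) / 2
                         else if k = 2 then (sg (fst i) - sg (snd i)) / 2 else 0)"

lemma wedge_point_simps:
  "wedge_point i $ 1 + wedge_point i $ 2 = sg (fst i)"
  "wedge_point i $ 1 - wedge_point i $ 2 = sg (snd i)"
  "wedge_point i $ 3 = 0"
  by (auto simp: wedge_point_def field_simps)

lemma wedge_point_sphere: "wedge_point i \<in> upper_hemisphere \<inter> open_wedge i"
proof -
  have "(norm (wedge_point i))\<^sup>2 = 1"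
    unfolding norm_vec3_sq by (auto simp: wedge_point_def sg_def)
  then have "norm (wedge_point i) = 1" using real_sqrt_unique[of "norm (wedge_point i)" 1] by simp
  then show ?thesis by (simp add: upper_hemisphere_def open_wedge_def wedge_point_simps)
qed

text \<open>Adding a small multiple of \<open>wedge_point i\<close> makes both inequalities strict
  without changing the height; dividing by the norm returns to the sphere.\<close>

lemma hemisphere_wedge_closure:
  "upper_hemisphere \<inter> wedge i \<subseteq> closure (upper_hemisphere \<inter> open_wedge i)"
proof
  fix y assume y: "y \<in> upper_hemisphere \<inter> wedge i"
  define v where "v n = y + (1 / real (Suc n)) *\<^sub>R wedge_point i" for n
  have v: "v n \<in> open_wedge i \<and> 0 \<le> v n $ 3" for n
  proof -
    have pos: "0 < 1 / real (Suc n)" by simp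
    have "sg (fst i) * (v n $ 1 + v n $ 2)
        = sg (fst i) * (y$1 + y$2) + 1 / real (Suc n) * (sg (fst i) * (wedge_point i $ 1 + wedge_point i $ 2))"
      unfolding v_def by (simp add: ring_distribs del: of_nat_Suc)
    moreover have "sg (snd i) * (v n $ 1 - v n $ 2)
        = sg (snd i) * (y$1 - y$2) + 1 / real (Suc n) * (sg (snd i) * (wedge_point i $ 1 - wedge_point i $ 2))"
      unfolding v_def by (simp add: ring_distribs diff_divide_distrib del: of_nat_Suc)
    ultimately show ?thesis using y pos
      by (simp add: open_wedge_def wedge_def v_def upper_hemisphere_def wedge_point_simps add_nonneg_pos del: of_nat_Suc)
  qed
  have nz: "v n \<noteq> 0" for n using v[of n] by (auto simp: open_wedge_def)
  have "(1 / norm (v n)) *\<^sub>R v n \<in> upper_hemisphere \<inter> open_wedge i" for n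
  proof -
    define k where "k = 1 / norm (v n)"
    have k: "0 < k" "k * norm (v n) = 1" using nz[of n] by (simp_all add: k_def)
    have "sg b * ((k *\<^sub>R v n) $ 1 + (k *\<^sub>R v n) $ 2) = k * (sg b * (v n $ 1 + v n $ 2))"
      "sg b * ((k *\<^sub>R v n) $ 1 - (k *\<^sub>R v n) $ 2) = k * (sg b * (v n $ 1 - v n $ 2))" for b
      by (simp_all only: vector_scaleR_component real_scaleR_def) (simp_all add: algebra_simps)
    then show ?thesis using v[of n] k unfolding k_def[symmetric] upper_hemisphere_def open_wedge_def
      by (simp only: Int_iff mem_Collect_eq) simp
  qed
  moreover have "v \<longlonglongrightarrow> y + 0 *\<^sub>R wedge_point i"
    unfolding v_def using LIMSEQ_inverse_real_of_nat by (intro tendsto_intros) (simp add: inverse_eq_divide)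
  then have "(\<lambda>n. (1 / norm (v n)) *\<^sub>R v n) \<longlonglongrightarrow> (1 / norm y) *\<^sub>R y"
    using y by (intro tendsto_intros) (auto simp: upper_hemisphere_def)
  then have "(\<lambda>n. (1 / norm (v n)) *\<^sub>R v n) \<longlonglongrightarrow> y" using y by (simp add: upper_hemisphere_def)
  ultimately show "y \<in> closure (upper_hemisphere \<inter> open_wedge i)"
    unfolding closure_sequential by (intro exI[of _ "\<lambda>n. (1 / norm (v n)) *\<^sub>R v n"]) blast
qed

section \<open>The hemisphere map carries triangles to spherical sectors\<close>

locale hemisphere_map =
  fixes hh :: "real^2 \<Rightarrow> real^3" and L :: real
  assumes base: "zorich_base L hh"
begin

lemma L_ge_1: "1 \<le> L"
  using base by (simp add: zorich_base_def)

lemma lower: "a \<in> sqQ \<Longrightarrow> b \<in> sqQ \<Longrightarrow> dist a b \<le> L * dist (hh a) (hh b)"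
  and upper: "a \<in> sqQ \<Longrightarrow> b \<in> sqQ \<Longrightarrow> dist (hh a) (hh b) \<le> L * dist a b"
  using base L_ge_1 by (simp_all add: zorich_base_def pos_divide_le_eq mult.commute)

lemma hh_inj: "a \<in> sqQ \<Longrightarrow> b \<in> sqQ \<Longrightarrow> hh a = hh b \<Longrightarrow> a = b"
  using lower[of a b] by simp

lemma continuous_hh: "continuous_on sqQ hh"
  using upper L_ge_1
  by (intro lipschitz_on_continuous_on[of L] lipschitz_onI) auto

lemma hh_image: "hh ` sqQ = upper_hemisphere"
  using base by (simp add: zorich_base_def)

lemma hh_sphere: "x \<in> sqQ \<Longrightarrow> norm (hh x) = 1" "x \<in> sqQ \<Longrightarrow> 0 \<le> hh x $ 3"
  using hh_image unfolding upper_hemisphere_def by blast+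

lemma hh_equator_iff:
  assumes "x \<in> sqQ"
  shows "hh x $ 3 = 0 \<longleftrightarrow> \<bar>x$1\<bar> = 1 \<or> \<bar>x$2\<bar> = 1"
proof -
  have fr: "hh ` frontier sqQ = equator" using base by (simp add: zorich_base_def)
  have "hh x $ 3 = 0 \<longleftrightarrow> hh x \<in> hh ` frontier sqQ"
    unfolding fr equator_def using hh_sphere[OF assms] by simp
  also have "\<dots> \<longleftrightarrow> x \<in> frontier sqQ"
    using hh_inj assms by (auto simp: frontier_sqQ)
  finally show ?thesis using assms by (simp add: frontier_sqQ)
qed

lemma diag_sqQ: "\<bar>t\<bar> \<le> 1 \<Longrightarrow> pt2 t (sg b * t) \<in> sqQ"
  by (auto simp: sqQ_def abs_mult)

lemma hh_diag:
  assumes "\<bar>t\<bar> \<le> 1"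
  shows "hh (pt2 t (sg b * t)) $ 1 = sg b * hh (pt2 t (sg b * t)) $ 2"
proof -
  have "t \<in> {-1..1}" using assms by auto
  then show ?thesis using base by (simp add: zorich_base_def sg_def)
qed

text \<open>The image of a diagonal joins two antipodal points of the equator inside a great
  semicircle, hence it is the whole semicircle.\<close>
lemma hh_diag_onto:
  assumes y: "y \<in> upper_hemisphere" "y$1 = sg b * y$2"
  shows "\<exists>t. \<bar>t\<bar> \<le> 1 \<and> y = hh (pt2 t (sg b * t))"
proof -
  define g where "g t = hh (pt2 t (sg b * t))" for t
  \<comment> \<open>On a diagonal plane the sphere becomes this ellipse, so a point of the upper
    hemisphere in that plane is determined by its second coordinate.\<close>
  have det: "2 * (u$2)\<^sup>2 + (u$3)\<^sup>2 = 1" if "norm u = 1" "u$1 = sg b * u$2" for u :: "real^3"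
    using norm_vec3_sq[of u] that by (simp add: power_mult_distrib)
  have g: "norm (g t) = 1" "g t $ 1 = sg b * g t $ 2" "0 \<le> g t $ 3" if "\<bar>t\<bar> \<le> 1" for t
    using that hh_diag hh_sphere[OF diag_sqQ] by (auto simp: g_def)
  have g3: "g t $ 3 = 0" if "\<bar>t\<bar> = 1" for t
    using that hh_equator_iff[OF diag_sqQ[of t b]] by (auto simp: g_def)
  have ends: "2 * (g t $ 2)\<^sup>2 = 1" if "\<bar>t\<bar> = 1" for t
    using det[OF g(1)[of t] g(2)[of t]] g3[of t] that by simp
  \<comment> \<open>The two ends are distinct equatorial points of the same plane, hence antipodal.
    The second coordinate along the diagonal then takes all intermediate values.\<close>
  have "g 1 \<noteq> g (- 1)"
    using hh_inj[OF diag_sqQ[of 1 b] diag_sqQ[of "-1" b]] unfolding g_def by (metis abs_1 abs_minus_cancel order_refl pt2_simps(1) one_neq_neg_one)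
  then have "g 1 $ 2 \<noteq> g (- 1) $ 2"
    using g(2)[of 1] g(2)[of "-1"] g3[of 1] g3[of "-1"] by (auto simp: vec_eq_iff forall_3)
  then have anti: "g (- 1) $ 2 = - g 1 $ 2"
  proof -
    have "(g 1 $ 2)\<^sup>2 = (g (- 1) $ 2)\<^sup>2" using ends[of 1] ends[of "-1"] by simp
    then show ?thesis using \<open>g 1 $ 2 \<noteq> g (- 1) $ 2\<close> by (auto simp: power2_eq_iff)
  qed
  have "continuous_on {-1..1} (\<lambda>t. g t $ 2)"
  proof -
    have "continuous_on {-1..1} (\<lambda>t::real. pt2 t (sg b * t))"
      unfolding pt2_def
    proof (rule continuous_on_vec_lambda)
      show "continuous_on {-1..1} (\<lambda>t::real. if i = 1 then t else sg b * t)" for i :: 2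
        by (cases "i = 1") (auto intro!: continuous_intros)
    qed
    then show ?thesis
      unfolding g_def by (intro continuous_intros continuous_on_compose2[OF continuous_hh])
        (auto intro!: diag_sqQ)
  qed
  then have con: "connected ((\<lambda>t. g t $ 2) ` {-1..1})"
    by (intro connected_continuous_image) auto
  have "2 * (y$2)\<^sup>2 \<le> 1" using det[of y] y by (auto simp: upper_hemisphere_def) (smt (verit) zero_le_power2)
  then have "\<bar>y$2\<bar> \<le> \<bar>g 1 $ 2\<bar>" using ends[of 1] by (simp add: abs_le_square_iff)
  moreover have "g 1 $ 2 \<in> (\<lambda>t. g t $ 2) ` {-1..1}" "g (-1) $ 2 \<in> (\<lambda>t. g t $ 2) ` {-1..1}"
    by (rule imageI, simp)+
  ultimately have "y$2 \<in> (\<lambda>t. g t $ 2) ` {-1..1}"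
    using anti connectedD_interval[OF con, of "g 1 $ 2" "g (-1) $ 2" "y$2"]
      connectedD_interval[OF con, of "g (-1) $ 2" "g 1 $ 2" "y$2"] by (cases "0 \<le> g 1 $ 2") auto
  then obtain t where "t \<in> {-1..1}" "y$2 = g t $ 2" by blast
  then have t: "\<bar>t\<bar> \<le> 1" "y$2 = g t $ 2" by auto
  have "(y$3)\<^sup>2 = (g t $ 3)\<^sup>2"
    using det[OF g(1,2)[OF t(1)]] det[of y] y t(2) by (simp add: upper_hemisphere_def)
  then have "y$3 = g t $ 3" using y g(3)[OF t(1)] by (simp add: upper_hemisphere_def power2_eq_iff_nonneg)
  then have "y = g t" using t y g(2)[OF t(1)] by (simp add: vec_eq_iff forall_3)
  then show ?thesis using t(1) unfolding g_def by blast
qed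

text \<open>The diagonal already fills the whole semicircle by \<open>hh_diag_onto\<close>, so
  injectivity leaves no other point of the square to be sent there.\<close>

lemma off_diag:
  assumes "x \<in> sqQ"
  shows "hh x $ 1 = sg b * hh x $ 2 \<longleftrightarrow> x$2 = sg b * x$1"
proof
  assume "hh x $ 1 = sg b * hh x $ 2"
  then obtain t where t: "\<bar>t\<bar> \<le> 1" "hh x = hh (pt2 t (sg b * t))"
    using hh_diag_onto[of "hh x" b] hh_image assms by blast
  then have "x = pt2 t (sg b * t)" using hh_inj[OF assms diag_sqQ] by blast
  then show "x$2 = sg b * x$1" by simp
next
  assume "x$2 = sg b * x$1"
  then have "x = pt2 (x$1) (sg b * x$1)" by (intro pt2_eqI) auto
  moreover have "\<bar>x$1\<bar> \<le> 1" using assms by (simp add: sqQ_def)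
  ultimately show "hh x $ 1 = sg b * hh x $ 2" using hh_diag by metis
qed

text \<open>By \<open>off_diag\<close> the connected image misses both diagonal planes, so both
  signs are constant on it.\<close>

lemma open_tri_into: "\<exists>j. hh ` open_tri i \<subseteq> open_wedge j"
proof -
  have con: "connected (hh ` open_tri i)"
    using convex_open_tri[of i] continuous_on_subset[OF continuous_hh, of "open_tri i"]
    by (intro connected_continuous_image convex_connected) (auto simp: open_tri_def)
  have off: "x \<in> sqQ" "hh x $ 1 + hh x $ 2 \<noteq> 0" "hh x $ 1 - hh x $ 2 \<noteq> 0" if "x \<in> open_tri i" for x
    using that off_diag[of x True] off_diag[of x False] by (auto simp: open_tri_def sg_def)
  have sign: "\<exists>b. \<forall>y\<in>hh ` open_tri i. 0 < sg b * \<phi> y"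
    if "continuous_on UNIV \<phi>" "\<forall>y\<in>hh ` open_tri i. \<phi> y \<noteq> 0" for \<phi> :: "real^3 \<Rightarrow> real"
  proof -
    have c: "connected (\<phi> ` hh ` open_tri i)"
      using con that(1) continuous_on_subset by (blast intro: connected_continuous_image)
    show ?thesis
    proof (rule ccontr)
      assume "\<not> ?thesis"
      then obtain u v where "u \<in> \<phi> ` hh ` open_tri i" "v \<in> \<phi> ` hh ` open_tri i" "u \<le> 0" "0 \<le> v"
        by (auto simp: sg_def not_less all_bool_eq) 
      then have "0 \<in> \<phi> ` hh ` open_tri i" using connectedD_interval[OF c] by blast
      then show False using that(2) by auto
    qed
  qed
  have "\<exists>b. \<forall>y\<in>hh ` open_tri i. 0 < sg b * (y$1 + y$2)" "\<exists>b. \<forall>y\<in>hh ` open_tri i. 0 < sg b * (y$1 - y$2)"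
    by (intro sign continuous_intros; use off in blast)+
  then obtain b c where "\<forall>y\<in>hh ` open_tri i. 0 < sg b * (y$1 + y$2)" "\<forall>y\<in>hh ` open_tri i. 0 < sg c * (y$1 - y$2)"
    by blast
  then show ?thesis by (intro exI[of _ "(b, c)"]) (auto simp: open_wedge_def)
qed

text \<open>Four triangles cover four sectors, so the correspondence between them is a permutation.\<close>
lemma tri_image: "\<exists>\<sigma>. \<forall>i. hh ` tri i = upper_hemisphere \<inter> wedge (\<sigma> i)"
proof -
  obtain \<sigma> where \<sigma>: "\<And>i. hh ` open_tri i \<subseteq> open_wedge (\<sigma> i)" using open_tri_into by metis
  have pre: "\<exists>k x. x \<in> open_tri k \<and> y = hh x \<and> \<sigma> k = i" if y: "y \<in> upper_hemisphere \<inter> open_wedge i" for y i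
  proof -
    obtain x where x: "x \<in> sqQ" "y = hh x" using y hh_image by blast
    have "x$1 + x$2 \<noteq> 0" "x$1 - x$2 \<noteq> 0"
      using off_diag[OF x(1), of True] off_diag[OF x(1), of False] y x(2) by (auto simp: sg_def open_wedge_def)
    then obtain b c where "0 < sg b * (x$1 + x$2)" "0 < sg c * (x$1 - x$2)"
      using ex_sg_pos by blast
    then have "x \<in> open_tri (b, c)" using x(1) by (simp add: open_tri_def)
    moreover have "\<sigma> (b, c) = i"
      using \<sigma>[of "(b, c)"] calculation x(2) y by (intro open_wedge_unique[of y]) auto
    ultimately show ?thesis using x(2) by blast
  qed
  \<comment> \<open>Each open wedge contains a point of the hemisphere, whose preimage lies off the
    diagonals and hence in some open triangle. A surjection of a finite set onto itself is
    injective.\<close>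
  have "surj \<sigma>" unfolding surj_def using pre[OF wedge_point_sphere] by metis
  then have inj: "inj \<sigma>" by (simp add: finite_UNIV_surj_inj)
  have sub: "upper_hemisphere \<inter> open_wedge (\<sigma> i) \<subseteq> hh ` tri i" for i
  proof
    fix y assume "y \<in> upper_hemisphere \<inter> open_wedge (\<sigma> i)"
    then obtain k x where "x \<in> open_tri k" "y = hh x" "\<sigma> k = \<sigma> i" using pre by blast
    then show "y \<in> hh ` tri i"
      using injD[OF inj, of k i] by (auto simp: open_tri_def tri_def)
  qed
  have triQ: "tri i \<subseteq> sqQ" for i by (auto simp: tri_def)
  have cl: "closure (open_tri i) \<subseteq> sqQ" for i
    using compact_sqQ by (intro closure_minimal) (auto simp: open_tri_def compact_imp_closed)
  have "hh ` tri i = upper_hemisphere \<inter> wedge (\<sigma> i)" for i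
  proof
    have "hh ` closure (open_tri i) \<subseteq> wedge (\<sigma> i)"
      using \<sigma>[of i] by (intro image_closure_subset[OF continuous_on_subset[OF continuous_hh cl] closed_wedge])
        (auto simp: wedge_def open_wedge_def)
    then show "hh ` tri i \<subseteq> upper_hemisphere \<inter> wedge (\<sigma> i)"
      using tri_closure[of i] triQ[of i] hh_image by blast
    have "tri i = sqQ \<inter> {x. 0 \<le> sg (fst i) * (x$1 + x$2)} \<inter> {x. 0 \<le> sg (snd i) * (x$1 - x$2)}"
      by (auto simp: tri_def)
    also have "compact \<dots>"
      by (intro compact_Int_closed compact_sqQ closed_Collect_le continuous_intros)
    finally have "closed (hh ` tri i)"
      using triQ continuous_on_subset[OF continuous_hh] by (blast intro: compact_imp_closed compact_continuous_image)
    then have "closure (upper_hemisphere \<inter> open_wedge (\<sigma> i)) \<subseteq> hh ` tri i"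
      using sub by (intro closure_minimal)
    then show "upper_hemisphere \<inter> wedge (\<sigma> i) \<subseteq> hh ` tri i"
      using hemisphere_wedge_closure by blast
  qed
  then show ?thesis by blast
qed

end

section \<open>Beams of the Zorich map\<close>

definition parity :: "int \<Rightarrow> real" where "parity k = (if even k then 1 else - 1)"

lemma parity_simps [simp]: "parity k * parity k = 1" "\<bar>parity k\<bar> = 1" "parity k * (parity k * r) = r"
  "parity 0 = 1"
  by (auto simp: parity_def)

lemma parity_add: "parity (k + l) = parity k * parity l" "parity (k - l) = parity k * parity l"
  by (auto simp: parity_def)

lemma parity_power: "(-1) ^ nat \<bar>k\<bar> = parity k"
  by (simp add: parity_def minus_one_power_iff even_nat_iff)

text \<open>On a face shared by two beams either index may be used, since reflection in that face
  fixes it. This frees later arguments from the choice made by \<open>round\<close>.\<close>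

lemma fold_coord_beam:
  assumes "0 < lam" "\<bar>t - 2 * of_int m * lam\<bar> \<le> lam"
  shows "fold_coord lam t = parity m * (t - 2 * of_int m * lam)"
    and "beam_index lam t = m \<or> \<bar>t - 2 * of_int m * lam\<bar> = lam"
proof -
  \<comment> \<open>\<open>round\<close> sends half-integers upwards, so only the right-hand face is
    assigned to the next beam.\<close>
  consider "t - 2 * of_int m * lam < lam" | "t = 2 * of_int m * lam + lam"
    using assms by linarith
  then have "fold_coord lam t = parity m * (t - 2 * of_int m * lam)
      \<and> (beam_index lam t = m \<or> \<bar>t - 2 * of_int m * lam\<bar> = lam)"
  proof cases
    case 1
    have "beam_index lam t = m"
      unfolding beam_index_def using assms 1
      by (intro round_unique) (auto simp: field_simps abs_le_iff)
    then show ?thesis by (simp add: fold_coord_def parity_power)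
  next
    case 2
    have "beam_index lam t = m + 1"
      unfolding beam_index_def using assms(1) 2
      by (intro round_unique) (auto simp: field_simps)
    then show ?thesis using 2 assms(1)
      by (simp add: fold_coord_def parity_power parity_add algebra_simps) (simp add: parity_def)
  qed
  then show "fold_coord lam t = parity m * (t - 2 * of_int m * lam)"
    "beam_index lam t = m \<or> \<bar>t - 2 * of_int m * lam\<bar> = lam" by auto
qed

lemma beam_exists:
  fixes t lam :: real
  assumes "0 < lam"
  shows "\<exists>m::int. \<bar>t - 2 * of_int m * lam\<bar> \<le> lam"
proof
  define z where "z = t / (2 * lam)"
  have "t - 2 * of_int (round z) * lam = (z - of_int (round z)) * (2 * lam)"
    using assms by (simp add: z_def field_simps)
  also have "\<bar>\<dots>\<bar> \<le> 1 / 2 * (2 * lam)"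
    unfolding abs_mult using assms of_int_round_abs_le[of z]
    by (intro mult_mono) (auto simp: abs_minus_commute)
  finally show "\<bar>t - 2 * of_int (round z) * lam\<bar> \<le> lam" by simp
qed

definition mk3 :: "real \<Rightarrow> real \<Rightarrow> real \<Rightarrow> real^3" where
  "mk3 a b c = (\<chi> i. if i = 1 then a else if i = 2 then b else c)"

lemma mk3_simps [simp]: "mk3 a b c $ 1 = a" "mk3 a b c $ 2 = b" "mk3 a b c $ 3 = c"
  by (simp_all add: mk3_def)

lemma vec3_eqI: "x$1 = y$1 \<Longrightarrow> x$2 = y$2 \<Longrightarrow> x$3 = y$3 \<Longrightarrow> x = y" for x y :: "real^3"
  by (simp add: vec_eq_iff forall_3)

definition tau :: "real^3 \<Rightarrow> real^3" where "tau y = mk3 (y$1) (y$2) (- y$3)"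

lemma tau_simps [simp]: "tau y $ 1 = y $ 1" "tau y $ 2 = y $ 2" "tau y $ 3 = - y $ 3" "tau (tau y) = y"
  by (simp_all add: tau_def vec_eq_iff forall_3)

lemma norm_eq_vec3: "(x$1 - y$1)\<^sup>2 = (x'$1 - y'$1)\<^sup>2 \<Longrightarrow> (x$2 - y$2)\<^sup>2 = (x'$2 - y'$2)\<^sup>2
    \<Longrightarrow> (x$3 - y$3)\<^sup>2 = (x'$3 - y'$3)\<^sup>2 \<Longrightarrow> dist x y = dist x' y'" for x y x' y' :: "real^3"
  unfolding dist_norm by (rule power2_eq_imp_eq) (auto simp: norm_vec3_sq)

lemma dist_tau [simp]: "dist (tau x) (tau y) = dist x y"
  by (rule norm_eq_vec3) (simp_all add: power2_eq_square algebra_simps)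

lemma norm_tau [simp]: "norm (tau x) = norm x"
  by (rule power2_eq_imp_eq) (auto simp: norm_vec3_sq)

lemma tau_eq_0_iff [simp]: "tau y = 0 \<longleftrightarrow> y = 0"
  by (metis norm_tau norm_eq_zero)

lemma tau_wedge [simp]: "tau y \<in> wedge i \<longleftrightarrow> y \<in> wedge i"
  by (simp add: wedge_def)

lemma convex_wedge: "convex (wedge i)"
proof (rule convexI)
  fix x y :: "real^3" and u v :: real
  assume "x \<in> wedge i" "y \<in> wedge i" and uv: "0 \<le> u" "0 \<le> v" "u + v = 1"
  then have "0 \<le> u * (sg (fst i) * (x$1 + x$2)) + v * (sg (fst i) * (y$1 + y$2))"
    "0 \<le> u * (sg (snd i) * (x$1 - x$2)) + v * (sg (snd i) * (y$1 - y$2))"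
    by (auto simp: wedge_def)
  then show "u *\<^sub>R x + v *\<^sub>R y \<in> wedge i" by (simp add: wedge_def algebra_simps)
qed

text \<open>A segment crossing the equatorial plane is cut at that plane, so that both parts can be
  pulled back within one half of a tile.\<close>
lemma segment_crossing:
  fixes y z :: "real^3"
  assumes "0 \<le> y$3" "z$3 \<le> 0"
  shows "\<exists>w \<in> closed_segment y z. w$3 = 0 \<and> dist y w \<le> dist y z \<and> dist w z \<le> dist y z"
proof -
  have "continuous_on (closed_segment y z) (\<lambda>w. w$3)" by (intro continuous_intros)
  then have con: "connected ((\<lambda>w. w$3) ` closed_segment y z)"
    by (intro connected_continuous_image) auto
  have "0 \<in> (\<lambda>w. w$3) ` closed_segment y z"
    using assms connectedD_interval[OF con, of "z$3" "y$3" 0] by auto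
  then obtain w where "w \<in> closed_segment y z" "w$3 = 0" by auto
  then show ?thesis
    using dist_in_closed_segment[of w y z] by (metis dist_commute)
qed

section \<open>Explicit form and symmetries of the Zorich map\<close>

locale zorich_map = hemisphere_map +
  fixes lam nu :: real
  assumes lam_pos: "0 < lam" and nu_lam: "1 \<le> nu * lam"
begin

abbreviation f :: "real^3 \<Rightarrow> real^3" where "f \<equiv> zorich hh lam nu"

definition radius :: "real^3 \<Rightarrow> real" where "radius x = nu * lam * exp (x$3)"

lemma nu_pos: "0 < nu"
proof -
  have "0 < nu * lam" using nu_lam by linarith
  then show ?thesis using lam_pos by (simp add: zero_less_mult_iff)
qed

lemma radius_pos: "0 < radius x"
  using nu_pos lam_pos by (simp add: radius_def)

lemma beam_mem:
  assumes "\<bar>x$1 - 2 * of_int m * lam\<bar> \<le> lam" "\<bar>x$2 - 2 * of_int n * lam\<bar> \<le> lam"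
  shows "pt2 (parity m * (x$1 - 2 * of_int m * lam) / lam) (parity n * (x$2 - 2 * of_int n * lam) / lam) \<in> sqQ"
proof -
  have "\<bar>parity k * d / lam\<bar> \<le> 1" if "\<bar>d\<bar> \<le> lam" for k d
    using that lam_pos by (simp add: abs_mult abs_divide)
  then show ?thesis using assms by (simp add: sqQ_def)
qed

text \<open>If \<open>m\<close> or \<open>n\<close> differs from the index chosen by
  \<open>round\<close>, the point is on a face. Then \<open>u\<close> is on the equator and the sign
  of its third coordinate is immaterial.\<close>

lemma f_beam:
  assumes "\<bar>x$1 - 2 * of_int m * lam\<bar> \<le> lam" "\<bar>x$2 - 2 * of_int n * lam\<bar> \<le> lam"
  defines "u \<equiv> hh (pt2 (parity m * (x$1 - 2 * of_int m * lam) / lam) (parity n * (x$2 - 2 * of_int n * lam) / lam))"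
  shows "f x = mk3 (radius x * u$1) (radius x * u$2) (parity (m + n) * (radius x * u$3))"
proof -
  note m = fold_coord_beam[OF lam_pos assms(1)] and n = fold_coord_beam[OF lam_pos assms(2)]
  have "(beam_index lam (x$1) = m \<and> beam_index lam (x$2) = n) \<or> u$3 = 0"
    unfolding u_def hh_equator_iff[OF beam_mem[OF assms(1,2)]]
    using m(2) n(2) lam_pos by (auto simp: abs_mult)
  then show ?thesis
    using m(1) n(1)
    by (intro vec3_eqI) (auto simp: zorich_def Let_def parity_power radius_def u_def mult_ac)
qed

lemma norm_f: "norm (f x) = radius x"
proof -
  obtain m n where mn: "\<bar>x$1 - 2 * of_int m * lam\<bar> \<le> lam" "\<bar>x$2 - 2 * of_int n * lam\<bar> \<le> lam"
    using beam_exists[OF lam_pos] by meson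
  define u where "u = hh (pt2 (parity m * (x$1 - 2 * of_int m * lam) / lam) (parity n * (x$2 - 2 * of_int n * lam) / lam))"
  have "norm u = 1" unfolding u_def by (rule hh_sphere[OF beam_mem[OF mn]])
  then have "(u$1)\<^sup>2 + (u$2)\<^sup>2 + (u$3)\<^sup>2 = 1" using norm_vec3_sq[of u] by simp
  moreover have "(norm (f x))\<^sup>2 = (radius x)\<^sup>2 * ((u$1)\<^sup>2 + (u$2)\<^sup>2 + (u$3)\<^sup>2)"
    unfolding norm_vec3_sq f_beam[OF mn] u_def[symmetric]
    by (simp add: power_mult_distrib parity_def distrib_left)
  ultimately have "(norm (f x))\<^sup>2 = (radius x)\<^sup>2" by (simp only: mult_1_right)
  then show ?thesis by (rule power2_eq_imp_eq) (simp_all add: less_imp_le radius_pos)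
qed

text \<open>This moves the edge with index \<open>(c, d)\<close>, which is the axis of the beam
  \<open>(c + d, c - d)\<close>, to the \<open>x3\<close>-axis. The two beam indices have equal
  parity, so the foldings combine to a half-turn or the identity, and the range is not
  reflected.\<close>

definition recentre :: "int \<Rightarrow> int \<Rightarrow> real^3 \<Rightarrow> real^3" where
  "recentre c d x = mk3 (parity (c + d) * (x$1 - 2 * lam * of_int (c + d)))
                        (parity (c + d) * (x$2 - 2 * lam * of_int (c - d))) (x$3)"

lemma f_recentre: "f (recentre c d x) = f x"
proof -
  obtain m n where mn: "\<bar>x$1 - 2 * of_int m * lam\<bar> \<le> lam" "\<bar>x$2 - 2 * of_int n * lam\<bar> \<le> lam"
    using beam_exists[OF lam_pos] by meson
  define s where "s = (if even (c + d) then 1 else - 1 :: int)"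
  have s: "of_int s = parity (c + d)" "\<And>k. parity (s * k) = parity k"
    by (auto simp: s_def parity_def)
  \<comment> \<open>These are the indices of the recentred beam. Both parities change by the factor
    \<open>parity (c + d)\<close>, which cancels the sign of the coordinates and drops out of
    \<open>m' + n'\<close>.\<close>
  define m' n' where "m' = s * (m - (c + d))" and "n' = s * (n - (c - d))"
  have p: "parity m' = parity (c + d) * parity m" "parity n' = parity (c + d) * parity n"
    unfolding m'_def n'_def s(2) by (simp_all add: parity_add mult_ac)
  have e: "recentre c d x $ 1 - 2 * of_int m' * lam = parity (c + d) * (x$1 - 2 * of_int m * lam)"
    "recentre c d x $ 2 - 2 * of_int n' * lam = parity (c + d) * (x$2 - 2 * of_int n * lam)"
    unfolding m'_def n'_def of_int_mult s(1) by (simp_all add: recentre_def algebra_simps)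
  have q: "parity (m' + n') = parity (m + n)"
    unfolding parity_add(1)[of m'] p by (simp add: parity_add mult_ac)
  have a: "parity m' * (parity (c + d) * r) = parity m * r" "parity n' * (parity (c + d) * r) = parity n * r" for r
    unfolding p by (simp_all add: mult_ac)
  have "\<bar>recentre c d x $ 1 - 2 * of_int m' * lam\<bar> \<le> lam" "\<bar>recentre c d x $ 2 - 2 * of_int n' * lam\<bar> \<le> lam"
    unfolding e abs_mult using mn by simp_all
  from f_beam[OF this] show ?thesis
    unfolding f_beam[OF mn] e a q by (simp add: radius_def recentre_def)
qed

text \<open>The reflection in the face of the central beam lying over the outer side of the triangle
  with signs \<open>(b, e)\<close>: a face \<open>x1 = const\<close> if the signs agree, a face
  \<open>x2 = const\<close> otherwise.\<close>

definition reflect :: "bool \<Rightarrow> bool \<Rightarrow> real^3 \<Rightarrow> real^3" where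
  "reflect b e x = (if b = e then mk3 (2 * sg b * lam - x$1) (x$2) (x$3) else mk3 (x$1) (2 * sg b * lam - x$2) (x$3))"

lemma reflect_reflect [simp]: "reflect b e (reflect b e x) = x"
  by (rule vec3_eqI) (auto simp: reflect_def)

lemma dist_reflect [simp]: "dist (reflect b e x) (reflect b e y) = dist x y"
  by (rule norm_eq_vec3) (cases "b = e"; simp add: reflect_def power2_commute)+

lemma radius_reflect [simp]: "radius (reflect b e x) = radius x"
  by (simp add: radius_def reflect_def)

text \<open>One beam index \<open>k\<close> becomes \<open>s - k\<close>, of opposite parity, while
  the offset in that beam changes sign. The folded point is the same and only the sign of the third
  coordinate flips.\<close>

lemma f_reflect: "f (reflect b e x) = tau (f x)"
proof -
  obtain m n where mn: "\<bar>x$1 - 2 * of_int m * lam\<bar> \<le> lam" "\<bar>x$2 - 2 * of_int n * lam\<bar> \<le> lam"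
    using beam_exists[OF lam_pos] by meson
  define s where "s = (if b then 1 else - 1 :: int)"
  have s: "of_int s = sg b" "\<And>k. parity (s - k) = - parity k" by (auto simp: s_def sg_def parity_def)
  show ?thesis
  proof (cases "b = e")
    case True
    have eq: "reflect b e x $ 1 - 2 * of_int (s - m) * lam = - (x$1 - 2 * of_int m * lam)"
      "reflect b e x $ 2 - 2 * of_int n * lam = x$2 - 2 * of_int n * lam"
      using True by (simp_all add: reflect_def s algebra_simps)
    have c: "\<bar>reflect b e x $ 1 - 2 * of_int (s - m) * lam\<bar> \<le> lam" "\<bar>reflect b e x $ 2 - 2 * of_int n * lam\<bar> \<le> lam"
      unfolding eq using mn by simp_all
    have par: "parity (s - m + n) = - parity (m + n)" "parity (s - m) * - r = parity m * r" for r
      unfolding s by (simp_all add: s parity_add(1))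
    show ?thesis
      unfolding f_beam[OF mn] f_beam[OF c] eq par by (intro vec3_eqI) simp_all
  next
    case False
    have eq: "reflect b e x $ 1 - 2 * of_int m * lam = x$1 - 2 * of_int m * lam"
      "reflect b e x $ 2 - 2 * of_int (s - n) * lam = - (x$2 - 2 * of_int n * lam)"
      using False by (simp_all add: reflect_def s algebra_simps)
    have c: "\<bar>reflect b e x $ 1 - 2 * of_int m * lam\<bar> \<le> lam" "\<bar>reflect b e x $ 2 - 2 * of_int (s - n) * lam\<bar> \<le> lam"
      unfolding eq using mn by simp_all
    have par: "parity (m + (s - n)) = - parity (m + n)" "parity (s - n) * - r = parity n * r" for r
      unfolding parity_add(1) s by simp_all
    show ?thesis
      unfolding f_beam[OF mn] f_beam[OF c] eq par by (intro vec3_eqI) simp_all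
  qed
qed

section \<open>Polar coordinates on a triangular prism\<close>

definition foot :: "real^3 \<Rightarrow> real^2" where "foot x = pt2 (x$1 / lam) (x$2 / lam)"

definition half :: "bool \<times> bool \<Rightarrow> (real^3) set" where "half i = {x. foot x \<in> tri i}"

lemma f_half:
  assumes "x \<in> half i"
  shows "f x = radius x *\<^sub>R hh (foot x)" "foot x \<in> sqQ" "0 \<le> f x $ 3"
proof -
  show Q: "foot x \<in> sqQ" using assms by (simp add: half_def tri_def)
  then have "\<bar>x$1 - 2 * of_int 0 * lam\<bar> \<le> lam" "\<bar>x$2 - 2 * of_int 0 * lam\<bar> \<le> lam"
    using lam_pos by (auto simp: sqQ_def foot_def)
  from f_beam[OF this] show eq: "f x = radius x *\<^sub>R hh (foot x)"
    by (intro vec3_eqI) (auto simp: foot_def)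
  show "0 \<le> f x $ 3" unfolding eq using hh_sphere(2)[OF Q] radius_pos[of x] by simp
qed

lemma radius_inj: "radius x = radius y \<longleftrightarrow> x$3 = y$3"
  using nu_pos lam_pos by (simp add: radius_def)

lemma half_inj: "x \<in> half i \<Longrightarrow> y \<in> half i \<Longrightarrow> f x = f y \<Longrightarrow> x = y"
proof -
  assume h: "x \<in> half i" "y \<in> half i" and eq: "f x = f y"
  have r: "radius x = radius y" using norm_f eq by metis
  then have "hh (foot x) = hh (foot y)"
    using eq radius_pos[of y] unfolding f_half(1)[OF h(1)] f_half(1)[OF h(2)] by simp
  then have "foot x = foot y" using hh_inj h f_half(2) by blast
  then show "x = y"
    using r lam_pos by (intro vec3_eqI) (auto simp: radius_inj foot_def vec_eq_iff forall_2)
qed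

lemma half_image:
  assumes "hh ` tri i = upper_hemisphere \<inter> wedge j"
  shows "f ` half i = wedge j \<inter> {y. 0 \<le> y$3} - {0}"
proof (intro set_eqI iffI)
  fix y assume "y \<in> f ` half i"
  then obtain x where x: "x \<in> half i" "y = f x" by blast
  have "hh (foot x) \<in> wedge j" using assms x(1) unfolding half_def by blast
  then have "0 \<le> radius x * (sg (fst j) * (hh (foot x) $ 1 + hh (foot x) $ 2))"
      "0 \<le> radius x * (sg (snd j) * (hh (foot x) $ 1 - hh (foot x) $ 2))"
    using radius_pos[of x] by (auto simp: wedge_def)
  then have "y \<in> wedge j" unfolding x(2) f_half(1)[OF x(1)] by (simp add: wedge_def algebra_simps)
  moreover have "y \<noteq> 0" using norm_f[of x] radius_pos[of x] x(2) by auto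
  ultimately show "y \<in> wedge j \<inter> {y. 0 \<le> y$3} - {0}" using f_half(3)[OF x(1)] x(2) by simp
next
  fix y assume y: "y \<in> wedge j \<inter> {y. 0 \<le> y$3} - {0}"
  define k where "k = inverse (norm y)"
  have k: "0 < k" "norm y * k = 1" using y by (auto simp: k_def)
  have "0 \<le> k * (sg (fst j) * (y$1 + y$2))" "0 \<le> k * (sg (snd j) * (y$1 - y$2))"
    using y k by (auto simp: wedge_def)
  then have "k *\<^sub>R y \<in> upper_hemisphere \<inter> wedge j"
    using y k by (simp add: upper_hemisphere_def wedge_def algebra_simps)
  then obtain p where p: "p \<in> tri i" "hh p = k *\<^sub>R y" using assms by (metis imageE)
  \<comment> \<open>The direction of \<open>y\<close> fixes the horizontal position through
    \<open>hh\<close>, and its norm fixes the height.\<close>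
  let ?x = "mk3 (lam * p$1) (lam * p$2) (ln (norm y / (nu * lam)))"
  have foot: "foot ?x = p" using lam_pos by (simp add: foot_def vec_eq_iff forall_2)
  then have h: "?x \<in> half i" using p by (simp add: half_def)
  have "radius ?x = norm y" using y nu_pos lam_pos by (simp add: radius_def)
  then have "f ?x = y" unfolding f_half(1)[OF h] foot p(2) using k by simp
  then show "y \<in> f ` half i" using h by (metis image_eqI)
qed

text \<open>Heights are logarithms of norms and directions are controlled by the lower Lipschitz
  bound of \<open>hh\<close>. The term \<open>2 * lam * L\<close> comes from the directions, the
  term 1 from the heights.\<close>

lemma half_expand:
  assumes x: "x \<in> half i" and y: "y \<in> half i" and m: "0 < m" "m \<le> radius x" "m \<le> radius y"
  shows "dist x y \<le> (2 * lam * L + 1) * dist (f x) (f y) / m"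
proof -
  let ?D = "dist (f x) (f y)"
  have r: "\<bar>radius x - radius y\<bar> \<le> ?D"
    using norm_triangle_ineq3[of "f x" "f y"] by (simp add: norm_f dist_norm)
  \<comment> \<open>This is the mean value bound for the logarithm on radii at least
    \<open>m\<close>, obtained from \<open>exp t \<ge> 1 + t\<close>.\<close>
  have third: "a - b \<le> ?D / m" if "exp a * c - exp b * c \<le> ?D" "m \<le> exp b * c" "0 < c" for a b c :: real
  proof (cases "b \<le> a")
    case True
    have "a - b \<le> exp (a - b) - 1" using exp_ge_add_one_self[of "a - b"] by linarith
    then have "m * (a - b) \<le> exp b * c * (exp (a - b) - 1)"
      using True that m(1) by (intro mult_mono) auto
    also have "\<dots> = exp a * c - exp b * c" by (simp add: exp_diff field_simps)
    finally show ?thesis using that(1) m(1) by (simp add: field_simps)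
  next
    case False
    have "0 \<le> ?D / m" using m(1) by simp
    then show ?thesis using False by linarith
  qed
  have d3: "\<bar>x$3 - y$3\<bar> \<le> ?D / m"
    using third[of "x$3" "nu * lam" "y$3"] third[of "y$3" "nu * lam" "x$3"] r m nu_lam
    by (simp add: radius_def mult.commute abs_le_iff)
  let ?u = "hh (foot x)" and ?v = "hh (foot y)"
  \<comment> \<open>Split the difference of the images into a change of direction at fixed radius
    and a change of radius; the latter is at most the distance of the images.\<close>
  have "radius x * dist ?u ?v \<le> 2 * ?D"
  proof -
    have "radius x *\<^sub>R (?u - ?v) = (f x - f y) + (radius y - radius x) *\<^sub>R ?v"
      unfolding f_half(1)[OF x] f_half(1)[OF y] by (simp add: algebra_simps)
    then have "norm (radius x *\<^sub>R (?u - ?v)) \<le> norm (f x - f y) + norm ((radius y - radius x) *\<^sub>R ?v)"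
      by (metis norm_triangle_ineq)
    then show ?thesis
      using r hh_sphere(1)[OF f_half(2)[OF y]] radius_pos[of x] by (simp add: dist_norm abs_minus_commute)
  qed
  then have "m * dist ?u ?v \<le> 2 * ?D" using mult_right_mono[OF m(2) zero_le_dist[of ?u ?v]] by linarith
  then have uv: "dist ?u ?v \<le> 2 * ?D / m" using m(1) by (simp add: field_simps)
  have "dist (foot x) (foot y) \<le> L * (2 * ?D / m)"
    using lower[OF f_half(2)[OF x] f_half(2)[OF y]] mult_left_mono[OF uv, of L] L_ge_1 by linarith
  then have h: "lam * dist (foot x) (foot y) \<le> lam * (L * (2 * ?D / m))" using lam_pos by (intro mult_left_mono) auto
  have "dist x y \<le> lam * dist (foot x) (foot y) + \<bar>x$3 - y$3\<bar>"
  proof (rule power2_le_imp_le)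
    have "lam\<^sup>2 * (dist (foot x) (foot y))\<^sup>2 = (x$1 - y$1)\<^sup>2 + (x$2 - y$2)\<^sup>2"
    proof -
      have "(dist (foot x) (foot y))\<^sup>2 = ((x$1 - y$1) / lam)\<^sup>2 + ((x$2 - y$2) / lam)\<^sup>2"
        unfolding dist_norm norm_vec2_sq by (simp add: foot_def diff_divide_distrib)
      then show ?thesis using lam_pos by (simp add: power_divide distrib_left)
    qed
    then have "(dist x y)\<^sup>2 = (lam * dist (foot x) (foot y))\<^sup>2 + \<bar>x$3 - y$3\<bar>\<^sup>2"
      unfolding dist_norm[of x] norm_vec3_sq by (simp add: power_mult_distrib)
    also have "\<dots> \<le> (lam * dist (foot x) (foot y) + \<bar>x$3 - y$3\<bar>)\<^sup>2"
      using lam_pos by (simp add: power2_sum)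
    finally show "(dist x y)\<^sup>2 \<le> (lam * dist (foot x) (foot y) + \<bar>x$3 - y$3\<bar>)\<^sup>2" .
  qed (use lam_pos in simp)
  also have "\<dots> \<le> lam * (L * (2 * ?D / m)) + ?D / m" using h d3 by linarith
  also have "\<dots> = (2 * lam * L + 1) * ?D / m" using m(1) by (simp add: field_simps)
  finally show ?thesis .
qed

section \<open>Beams adjacent to the axis\<close>

text \<open>Each beam has exactly one edge on which \<open>x\<^sub>1 + x\<^sub>2\<close> and \<open>x\<^sub>1 - x\<^sub>2\<close> both lie in \<open>4\<lambda>\<int>\<close>; it
  is indexed by \<open>(c, d)\<close>, and the signs \<open>(b, e)\<close> tell which of the four beams around it is meant.\<close>
fun tile :: "int \<times> int \<times> bool \<times> bool \<Rightarrow> (real^3) set" where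
  "tile (c, d, b, e) = {x. 0 \<le> sg b * (x$1 + x$2 - 4 * lam * of_int c) \<and> sg b * (x$1 + x$2 - 4 * lam * of_int c) \<le> 2 * lam
                         \<and> 0 \<le> sg e * (x$1 - x$2 - 4 * lam * of_int d) \<and> sg e * (x$1 - x$2 - 4 * lam * of_int d) \<le> 2 * lam}"

text \<open>The third condition is the bound on both coordinates, since
  \<open>|x1 + x2| + |x1 - x2|\<close> is twice the larger of \<open>|x1|\<close> and
  \<open>|x2|\<close>.\<close>

lemma half_iff:
  "x \<in> half (b, e) \<longleftrightarrow> 0 \<le> sg b * (x$1 + x$2) \<and> 0 \<le> sg e * (x$1 - x$2)
      \<and> sg b * (x$1 + x$2) + sg e * (x$1 - x$2) \<le> 2 * lam"
proof -
  have "\<bar>r / lam\<bar> \<le> 1 \<longleftrightarrow> \<bar>r\<bar> \<le> lam" for r using lam_pos by (auto simp: field_simps)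
  moreover have "0 \<le> sg c * (r / lam + s / lam) \<longleftrightarrow> 0 \<le> sg c * (r + s)"
    "0 \<le> sg c * (r / lam - s / lam) \<longleftrightarrow> 0 \<le> sg c * (r - s)" for c r s
    using lam_pos by (cases c; simp add: sg_def field_simps)+
  ultimately have "x \<in> half (b, e) \<longleftrightarrow> \<bar>x$1\<bar> \<le> lam \<and> \<bar>x$2\<bar> \<le> lam \<and> 0 \<le> sg b * (x$1 + x$2) \<and> 0 \<le> sg e * (x$1 - x$2)"
    unfolding half_def tri_def foot_def sqQ_def mem_Collect_eq pt2_simps fst_conv snd_conv by blast
  then show ?thesis
    by (cases b; cases e) (auto simp: sg_def abs_le_iff)
qed

text \<open>In the signed diagonal coordinates \<open>(p, q)\<close> the reflection is
  \<open>(2 * lam - q, 2 * lam - p)\<close>. It exchanges the two triangles into which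
  \<open>p + q = 2 * lam\<close> cuts the square cross section.\<close>

lemma reflect_diag:
  "sg b * (reflect b e x $ 1 + reflect b e x $ 2) = 2 * lam - sg e * (x$1 - x$2)"
  "sg e * (reflect b e x $ 1 - reflect b e x $ 2) = 2 * lam - sg b * (x$1 + x$2)"
  by (cases b; cases e; simp add: reflect_def sg_def)+

lemma base_tile_iff: "x \<in> tile (0, 0, b, e) \<longleftrightarrow> x \<in> half (b, e) \<or> reflect b e x \<in> half (b, e)"
  unfolding half_iff reflect_diag by auto

text \<open>Only the frontier of the square goes to the equator, and the triangle meets that
  frontier exactly in the side fixed by the reflection.\<close>

lemma half_equator:
  assumes "x \<in> half (b, e)" "f x $ 3 = 0"
  shows "reflect b e x = x"
proof -
  have Q: "foot x \<in> sqQ" and "hh (foot x) $ 3 = 0"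
    using f_half[OF assms(1)] assms(2) radius_pos[of x] by auto
  then have "\<bar>x$1\<bar> = lam \<or> \<bar>x$2\<bar> = lam"
    using lam_pos unfolding hh_equator_iff[OF Q] by (auto simp: foot_def field_simps)
  then show ?thesis
    using assms(1) unfolding half_iff
    by (cases b; cases e) (auto simp: reflect_def sg_def vec_eq_iff forall_3)
qed

text \<open>One half of the tile goes to the part of the wedge with \<open>x3 \<ge> 0\<close> and,
  by \<open>f_reflect\<close>, the other to its mirror image. The images overlap only at height 0,
  where the two halves share a face.\<close>

lemma base_tile_bij:
  assumes "hh ` tri (b, e) = upper_hemisphere \<inter> wedge j"
  shows "bij_betw f (tile (0, 0, b, e)) (wedge j - {0})"
  unfolding bij_betw_def
proof
  note img = half_image[OF assms]
  have mixed: "x = y" if "x \<in> half (b, e)" "reflect b e y \<in> half (b, e)" "f x = f y" for x y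
  proof -
    have "f (reflect b e y) = tau (f x)" using that(3) f_reflect by simp
    then have "f (reflect b e y) $ 3 = - f x $ 3" by simp
    then have 0: "f x $ 3 = 0" using f_half(3)[OF that(1)] f_half(3)[OF that(2)] by linarith
    then have "f x = f (reflect b e y)"
      unfolding \<open>f (reflect b e y) = tau (f x)\<close> by (intro vec3_eqI) auto
    then have "x = reflect b e y" using half_inj that by blast
    then show ?thesis using half_equator[OF that(1) 0] by simp
  qed
  show "inj_on f (tile (0, 0, b, e))"
  proof (rule inj_onI)
    fix x y assume t: "x \<in> tile (0, 0, b, e)" "y \<in> tile (0, 0, b, e)" and eq: "f x = f y"
    have "f (reflect b e x) = f (reflect b e y)" using eq by (simp add: f_reflect)
    then have "reflect b e x = reflect b e y" if "reflect b e x \<in> half (b, e)" "reflect b e y \<in> half (b, e)"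
      using that half_inj by blast
    then have "x = y" if "reflect b e x \<in> half (b, e)" "reflect b e y \<in> half (b, e)"
      using that reflect_reflect by metis
    then show "x = y"
      using t[unfolded base_tile_iff] half_inj[OF _ _ eq] mixed[OF _ _ eq] mixed[OF _ _ eq[symmetric]] by metis
  qed
  have tile: "tile (0, 0, b, e) = half (b, e) \<union> reflect b e ` half (b, e)"
  proof (intro set_eqI iffI)
    fix x assume "x \<in> tile (0, 0, b, e)"
    then show "x \<in> half (b, e) \<union> reflect b e ` half (b, e)"
      unfolding base_tile_iff using reflect_reflect by (metis UnCI image_eqI)
  qed (unfold base_tile_iff, auto)
  have "f ` tile (0, 0, b, e) = f ` half (b, e) \<union> tau ` f ` half (b, e)"
    unfolding tile image_Un image_image f_reflect ..
  also have "\<dots> = wedge j - {0}"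
  proof (intro set_eqI iffI)
    fix y assume "y \<in> f ` half (b, e) \<union> tau ` f ` half (b, e)"
    then show "y \<in> wedge j - {0}" unfolding img by auto
  next
    fix y assume y: "y \<in> wedge j - {0}"
    then have "y \<in> f ` half (b, e)" if "0 \<le> y$3" unfolding img using that by auto
    moreover have "tau y \<in> f ` half (b, e)" if "y$3 \<le> 0"
      unfolding img using that y by simp
    ultimately show "y \<in> f ` half (b, e) \<union> tau ` f ` half (b, e)"
      by (metis UnI1 UnI2 image_eqI linear tau_simps(4))
  qed
  finally show "f ` tile (0, 0, b, e) = wedge j - {0}" .
qed

text \<open>The segment between the images stays in the convex wedge and crosses the plane
  \<open>x3 = 0\<close> at some \<open>w\<close>. The preimage of \<open>w\<close> is on the common
  face, so \<open>half_expand\<close> applies on either side of it; this costs a factor 2.\<close>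

lemma mixed_expand:
  assumes img: "hh ` tri (b, e) = upper_hemisphere \<inter> wedge j"
    and x: "x \<in> half (b, e)" and y: "reflect b e y \<in> half (b, e)"
    and m: "0 < m" "\<And>v. v \<in> closed_segment (f x) (f y) \<Longrightarrow> m \<le> norm v"
  shows "dist x y \<le> 2 * (2 * lam * L + 1) * dist (f x) (f y) / m"
proof -
  let ?K = "2 * lam * L + 1"
  have "f y $ 3 \<le> 0" using f_half(3)[OF y] by (simp add: f_reflect)
  then obtain w where w: "w \<in> closed_segment (f x) (f y)" "w$3 = 0"
      "dist (f x) w \<le> dist (f x) (f y)" "dist w (f y) \<le> dist (f x) (f y)"
    using segment_crossing[of "f x" "f y"] f_half(3)[OF x] by blast
  have "f x \<in> wedge j" "f y \<in> wedge j"
  proof -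
    have "f x \<in> f ` half (b, e)" using x by blast
    moreover have "tau (f y) \<in> f ` half (b, e)" using imageI[OF y, of f] by (simp add: f_reflect)
    ultimately show "f x \<in> wedge j" "f y \<in> wedge j" unfolding half_image[OF img] by simp_all
  qed
  then have "w \<in> wedge j" using w(1) convex_wedge closed_segment_subset by blast
  moreover have "w \<noteq> 0" using m w(1) by force
  ultimately have "w \<in> f ` half (b, e)" unfolding half_image[OF img] using w(2) by simp
  then obtain z where z: "z \<in> half (b, e)" "f z = w" by blast
  have rz: "reflect b e z = z" using half_equator z w(2) by simp
  have r: "m \<le> radius x" "m \<le> radius y" "m \<le> radius z"
    using m(2)[of "f x"] m(2)[of "f y"] m(2)[OF w(1)] z(2) by (auto simp flip: norm_f)
  have K: "0 \<le> ?K" using lam_pos L_ge_1 by simp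
  have "dist x z \<le> ?K * dist (f x) w / m" using half_expand[OF x z(1) m(1)] r z by simp
  also have "\<dots> \<le> ?K * dist (f x) (f y) / m" using w K m(1) by (intro divide_right_mono mult_left_mono) auto
  finally have 1: "dist x z \<le> ?K * dist (f x) (f y) / m" .
  have "tau w = w" using w(2) by (intro vec3_eqI) auto
  then have tw: "dist w (tau (f y)) = dist w (f y)" by (metis dist_tau)
  have "dist z y = dist z (reflect b e y)" using dist_reflect[of b e z y] rz by simp
  also have "\<dots> \<le> ?K * dist w (tau (f y)) / m" using half_expand[OF z(1) y m(1)] r z by (simp add: f_reflect)
  also have "\<dots> \<le> ?K * dist (f x) (f y) / m"
    unfolding tw using w K m(1) by (intro divide_right_mono mult_left_mono) auto
  finally have "dist z y \<le> ?K * dist (f x) (f y) / m" .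
  moreover have "c \<le> 2 * t" if "a \<le> t" "b \<le> t" "c \<le> a + b" for a b c t :: real using that by linarith
  ultimately have "dist x y \<le> 2 * (?K * dist (f x) (f y) / m)" using 1 dist_triangle by blast
  then show ?thesis by (simp only: mult.assoc times_divide_eq_right)
qed

lemma base_tile_expand:
  assumes img: "hh ` tri (b, e) = upper_hemisphere \<inter> wedge j"
    and x: "x \<in> tile (0, 0, b, e)" and y: "y \<in> tile (0, 0, b, e)"
    and near: "dist (f x) (f y) \<le> norm (f x) / 2"
  shows "dist x y \<le> 4 * (2 * lam * L + 1) * dist (f x) (f y) / norm (f x)"
proof -
  \<comment> \<open>By the assumption \<open>near\<close>, the whole segment between the images
    stays at distance at least \<open>m\<close> from 0. Halving the norm doubles the constant once
    more.\<close>
  define m where "m = norm (f x) / 2"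
  have m: "0 < m" using norm_f[of x] radius_pos[of x] by (simp add: m_def)
  have seg: "m \<le> norm v" if v: "v \<in> closed_segment (f x) (f y)" for v
  proof -
    have "dist v (f x) \<le> dist (f x) (f y)" using dist_in_closed_segment[OF v] by simp
    moreover have "norm (f x) \<le> norm v + dist v (f x)" using norm_triangle_sub[of "f x" v] by (simp add: dist_norm norm_minus_commute)
    ultimately show ?thesis using near by (simp add: m_def)
  qed
  have r: "m \<le> radius x" "m \<le> radius y" using seg[of "f x"] seg[of "f y"] by (auto simp flip: norm_f)
  have K: "0 \<le> (2 * lam * L + 1) * dist (f x) (f y) / m" using lam_pos L_ge_1 m by simp
  have two: "2 * (2 * lam * L + 1) * dist (f x) (f y) / m = 2 * ((2 * lam * L + 1) * dist (f x) (f y) / m)"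
    by (simp add: mult.assoc)
  have double: "dist x y \<le> 2 * (2 * lam * L + 1) * dist (f x) (f y) / m"
    if "dist x y \<le> (2 * lam * L + 1) * dist (f x) (f y) / m"
  proof -
    have "d \<le> 2 * a" if "d \<le> a" "0 \<le> a" for d a :: real using that by linarith
    from this[OF that K] show ?thesis unfolding two .
  qed
  have "dist x y \<le> 2 * (2 * lam * L + 1) * dist (f x) (f y) / m"
  proof (cases "x \<in> half (b, e)")
    case True
    then show ?thesis
    proof (cases "y \<in> half (b, e)")
      case yh: True
      show ?thesis using double half_expand[OF True yh m r] by blast
    next
      case False
      then show ?thesis using mixed_expand[OF img True _ m seg] y base_tile_iff by blast
    qed
  next
    case False
    then have xh: "reflect b e x \<in> half (b, e)" using x base_tile_iff by blast
    show ?thesis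
    proof (cases "y \<in> half (b, e)")
      case True
      have "dist y x \<le> 2 * (2 * lam * L + 1) * dist (f y) (f x) / m"
        by (rule mixed_expand[OF img True xh m]) (use seg closed_segment_commute in blast)
      then show ?thesis by (simp add: dist_commute)
    next
      case False
      then have yh: "reflect b e y \<in> half (b, e)" using y base_tile_iff by blast
      have "dist x y \<le> (2 * lam * L + 1) * dist (f x) (f y) / m"
        using half_expand[OF xh yh m] r by (simp add: f_reflect)
      then show ?thesis by (rule double)
    qed
  qed
  then show ?thesis unfolding m_def by (simp add: field_simps)
qed

end

section \<open>All tiles and their edges, by recentring\<close>

lemma sg_eq_iff [simp]: "sg (b = c) = sg b * sg c"
  by (auto simp: sg_def)

lemma sg_even: "sg (even k) = parity k"
  by (simp add: sg_def parity_def)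

definition diag_line :: "real \<Rightarrow> real \<Rightarrow> (real^3) set" where
  "diag_line a b = {x. x$1 + x$2 = a \<and> x$1 - x$2 = b}"

lemma connected_diag_line: "connected (diag_line a b)"
proof -
  have "convex (diag_line a b)"
  proof (rule convexI)
    fix x y :: "real^3" and u v :: real
    assume xy: "x \<in> diag_line a b" "y \<in> diag_line a b" and uv: "u + v = 1"
    have "(u *\<^sub>R x + v *\<^sub>R y) $ 1 + (u *\<^sub>R x + v *\<^sub>R y) $ 2 = u * (x$1 + x$2) + v * (y$1 + y$2)"
      "(u *\<^sub>R x + v *\<^sub>R y) $ 1 - (u *\<^sub>R x + v *\<^sub>R y) $ 2 = u * (x$1 - x$2) + v * (y$1 - y$2)"
      by (simp_all add: algebra_simps)
    moreover have "u * r + v * r = r" for r using uv by (metis distrib_right mult_1)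
    ultimately show "u *\<^sub>R x + v *\<^sub>R y \<in> diag_line a b" using xy by (simp add: diag_line_def)
  qed
  then show ?thesis by (rule convex_connected)
qed

context zorich_map
begin

text \<open>Recentring changes both diagonal signs when \<open>c + d\<close> is odd;
  \<open>b = even (c + d)\<close> encodes the product of the two signs.\<close>

definition target_of :: "(bool \<times> bool \<Rightarrow> bool \<times> bool) \<Rightarrow> int \<times> int \<times> bool \<times> bool \<Rightarrow> bool \<times> bool" where
  "target_of \<sigma> = (\<lambda>(c, d, b, e). \<sigma> (b = even (c + d), e = even (c + d)))"

definition even_line :: "int \<times> int \<times> bool \<times> bool \<Rightarrow> (real^3) set" where
  "even_line = (\<lambda>(c, d, b, e). diag_line (4 * lam * of_int c) (4 * lam * of_int d))"

definition odd_line :: "int \<times> int \<times> bool \<times> bool \<Rightarrow> (real^3) set" where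
  "odd_line = (\<lambda>(c, d, b, e). diag_line (4 * lam * of_int c + 2 * lam * sg b) (4 * lam * of_int d + 2 * lam * sg e))"

definition vaxis :: "(real^3) set" where "vaxis = diag_line 0 0"

lemma mem_vaxis: "x \<in> vaxis \<longleftrightarrow> x$1 = 0 \<and> x$2 = 0"
  by (auto simp: vaxis_def diag_line_def)

lemma recentre_diag:
  "recentre c d x $ 1 + recentre c d x $ 2 = parity (c + d) * (x$1 + x$2 - 4 * lam * of_int c)"
  "recentre c d x $ 1 - recentre c d x $ 2 = parity (c + d) * (x$1 - x$2 - 4 * lam * of_int d)"
  by (simp_all add: recentre_def algebra_simps)

lemma dist_recentre: "dist (recentre c d x) (recentre c d y) = dist x y"
proof -
  have "parity k * u - parity k * v = parity k * (u - v)" for k u v by (simp add: algebra_simps)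
  then show ?thesis
    by (intro norm_eq_vec3) (simp_all add: recentre_def power_mult_distrib parity_def power2_commute)
qed

lemma recentre_tile:
  "recentre c d x \<in> tile (0, 0, b = even (c + d), e = even (c + d)) \<longleftrightarrow> x \<in> tile (c, d, b, e)"
proof -
  have *: "s * parity k * (parity k * r) = s * r" for s k r by (simp add: mult.assoc)
  show ?thesis
    unfolding tile.simps mem_Collect_eq recentre_diag sg_eq_iff sg_even
    by (simp only: of_int_0 mult_zero_right diff_zero *)
qed

lemma recentre_surj: "\<exists>x. recentre c d x = y"
proof -
  let ?s = "parity (c + d)"
  have "recentre c d (mk3 (2 * lam * of_int (c + d) + ?s * y$1) (2 * lam * of_int (c - d) + ?s * y$2) (y$3)) = y"
    by (rule vec3_eqI) (simp_all add: recentre_def)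
  then show ?thesis by blast
qed

lemma recentre_inj: "recentre c d x = recentre c d y \<Longrightarrow> x = y"
  using dist_recentre[of c d x y] by simp

lemma recentre_image: "recentre c d ` tile (c, d, b, e) = tile (0, 0, b = even (c + d), e = even (c + d))"
proof (intro set_eqI iffI)
  fix y assume y: "y \<in> tile (0, 0, b = even (c + d), e = even (c + d))"
  obtain x where "recentre c d x = y" using recentre_surj by blast
  then show "y \<in> recentre c d ` tile (c, d, b, e)" using y recentre_tile by blast
qed (use recentre_tile in blast)

lemma tile_bij:
  assumes "\<And>i. hh ` tri i = upper_hemisphere \<inter> wedge (\<sigma> i)"
  shows "bij_betw f (tile t) (wedge (target_of \<sigma> t) - {0})"
proof -
  obtain c d b e where t: "t = (c, d, b, e)" by (cases t)
  have "bij_betw (recentre c d) (tile t) (tile (0, 0, b = even (c + d), e = even (c + d)))"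
    unfolding bij_betw_def t recentre_image using recentre_inj by (auto intro: inj_onI)
  moreover have "bij_betw f (tile (0, 0, b = even (c + d), e = even (c + d))) (wedge (target_of \<sigma> t) - {0})"
    using base_tile_bij[OF assms] unfolding t target_of_def prod.case .
  ultimately have "bij_betw (f \<circ> recentre c d) (tile t) (wedge (target_of \<sigma> t) - {0})"
    by (rule bij_betw_trans)
  then show ?thesis by (simp add: o_def f_recentre)
qed

lemma tile_expand:
  assumes "\<And>i. hh ` tri i = upper_hemisphere \<inter> wedge (\<sigma> i)"
    and "x \<in> tile t" "y \<in> tile t" "dist (f x) (f y) \<le> norm (f x) / 2"
  shows "dist x y \<le> 4 * (2 * lam * L + 1) * dist (f x) (f y) / norm (f x)"
proof -
  obtain c d b e where t: "t = (c, d, b, e)" by (cases t)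
  show ?thesis
    using base_tile_expand[OF assms(1), of "recentre c d x" "b = even (c + d)" "e = even (c + d)" "recentre c d y"]
      assms(2-4)[unfolded t]
    unfolding f_recentre dist_recentre recentre_tile by blast
qed

text \<open>The axis is the intersection of the two diagonal planes, so this is
  \<open>off_diag\<close> used for both diagonals.\<close>

lemma half_axis:
  assumes "x \<in> half i"
  shows "f x \<in> vaxis \<longleftrightarrow> x \<in> vaxis"
proof -
  let ?p = "foot x"
  have "f x \<in> vaxis \<longleftrightarrow> radius x * (hh ?p $ 1 + hh ?p $ 2) = 0 \<and> radius x * (hh ?p $ 1 - hh ?p $ 2) = 0"
    unfolding f_half(1)[OF assms] vaxis_def diag_line_def by (simp add: algebra_simps)
  also have "\<dots> \<longleftrightarrow> hh ?p $ 1 = sg False * hh ?p $ 2 \<and> hh ?p $ 1 = sg True * hh ?p $ 2"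
    using radius_pos[of x] by (auto simp: sg_def)
  also have "\<dots> \<longleftrightarrow> ?p $ 2 = sg False * ?p $ 1 \<and> ?p $ 2 = sg True * ?p $ 1"
    unfolding off_diag[OF f_half(2)[OF assms]] ..
  also have "\<dots> \<longleftrightarrow> x \<in> vaxis"
    using lam_pos by (auto simp: foot_def sg_def vaxis_def diag_line_def)
  finally show ?thesis .
qed

lemma axis_half: "x \<in> vaxis \<Longrightarrow> x \<in> half (b, e)"
  using lam_pos unfolding half_iff mem_vaxis by simp

lemma base_tile_axis:
  assumes "x \<in> tile (0, 0, b, e)"
  shows "f x \<in> vaxis \<longleftrightarrow> x \<in> vaxis \<or> reflect b e x \<in> vaxis"
proof -
  have tau: "tau y \<in> vaxis \<longleftrightarrow> y \<in> vaxis" for y by (simp add: vaxis_def diag_line_def)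
  have ref: "f x \<in> vaxis \<longleftrightarrow> f (reflect b e x) \<in> vaxis" by (simp add: f_reflect tau)
  show ?thesis
    using assms unfolding base_tile_iff
    by (metis half_axis axis_half ref)
qed

lemma sg_mult_eq: "sg b * r = s \<longleftrightarrow> r = s * sg b"
  by (auto simp: sg_def)

lemma reflect_axis: "reflect b e x \<in> vaxis \<longleftrightarrow> x \<in> diag_line (2 * lam * sg b) (2 * lam * sg e)"
proof -
  have "reflect b e x \<in> vaxis \<longleftrightarrow> sg b * (reflect b e x $ 1 + reflect b e x $ 2) = 0 \<and> sg e * (reflect b e x $ 1 - reflect b e x $ 2) = 0"
    by (auto simp: vaxis_def diag_line_def)
  also have "\<dots> \<longleftrightarrow> sg e * (x$1 - x$2) = 2 * lam \<and> sg b * (x$1 + x$2) = 2 * lam"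
    unfolding reflect_diag by auto
  finally show ?thesis unfolding sg_mult_eq diag_line_def by auto
qed

lemma recentre_axis: "recentre c d x \<in> vaxis \<longleftrightarrow> x \<in> diag_line (4 * lam * of_int c) (4 * lam * of_int d)"
  unfolding vaxis_def diag_line_def mem_Collect_eq recentre_diag by (auto simp: parity_def)

lemma recentre_odd:
  "recentre c d x \<in> diag_line (2 * lam * sg (b = even (c + d))) (2 * lam * sg (e = even (c + d)))
    \<longleftrightarrow> x \<in> diag_line (4 * lam * of_int c + 2 * lam * sg b) (4 * lam * of_int d + 2 * lam * sg e)"
  unfolding diag_line_def mem_Collect_eq recentre_diag sg_eq_iff sg_even by (auto simp: parity_def)

lemma tile_lines: "even_line t \<union> odd_line t = {x \<in> tile t. f x \<in> vaxis}"
proof -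
  obtain c d b e where t: "t = (c, d, b, e)" by (cases t)
  have sub: "x \<in> tile t" if "x \<in> even_line t \<union> odd_line t" for x
    using that lam_pos by (auto simp: t even_line_def odd_line_def diag_line_def algebra_simps) (auto simp: sg_def)
  have "f x \<in> vaxis \<longleftrightarrow> x \<in> even_line t \<union> odd_line t" if "x \<in> tile t" for x
    using base_tile_axis[of "recentre c d x" "b = even (c + d)" "e = even (c + d)"] that recentre_tile
    unfolding t f_recentre reflect_axis recentre_axis recentre_odd even_line_def odd_line_def by simp
  then show ?thesis using sub by blast
qed

lemma odd_line_near:
  assumes "x \<in> tile t"
  shows "\<exists>y\<in>odd_line t. dist x y \<le> 4 * lam"
proof -
  obtain c d b e where t: "t = (c, d, b, e)" by (cases t)
  define p q where "p = 4 * lam * of_int c + 2 * lam * sg b" and "q = 4 * lam * of_int d + 2 * lam * sg e"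
  let ?y = "mk3 ((p + q) / 2) ((p - q) / 2) (x$3)"
  have "?y \<in> odd_line t" by (simp add: t odd_line_def diag_line_def p_def q_def add_divide_distrib diff_divide_distrib)
  moreover have "\<bar>x$1 + x$2 - p\<bar> \<le> 2 * lam" "\<bar>x$1 - x$2 - q\<bar> \<le> 2 * lam"
    using assms unfolding t p_def q_def by (auto simp: sg_def abs_le_iff split: if_splits)
  then have "\<bar>x$1 - (p + q) / 2\<bar> \<le> 2 * lam" "\<bar>x$2 - (p - q) / 2\<bar> \<le> 2 * lam"
    by (auto simp: abs_le_iff field_simps)
  then have "dist x ?y \<le> 4 * lam"
    using norm_le_l1_cart[of "x - ?y"] by (simp add: dist_norm sum_3)
  ultimately show ?thesis by blast
qed

section \<open>Tiling the wedges\<close>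

lemma tile_subset_wedge:
  assumes "0 \<le> sg s * (4 * lam * of_int c)" "0 \<le> sg s * (4 * lam * of_int c + 2 * lam * sg b)"
    and "0 \<le> sg r * (4 * lam * of_int d)" "0 \<le> sg r * (4 * lam * of_int d + 2 * lam * sg e)"
  shows "tile (c, d, b, e) \<subseteq> wedge (s, r)"
proof -
  have "0 \<le> sg s * p" if "0 \<le> sg s * a" "0 \<le> sg s * (a + 2 * lam * sg b)" "0 \<le> sg b * (p - a)" "sg b * (p - a) \<le> 2 * lam"
    for s b a p
    using that by (cases s; cases b) (auto simp: sg_def)
  note * = this
  show ?thesis
    using *[OF assms(1,2)] *[OF assms(3,4)] by (auto simp: wedge_def)
qed

text \<open>One diagonal coordinate: a period of length \<open>4 * lam\<close> consists of an
  interval leading outwards from its inner anchor and one leading inwards from the next anchor,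
  which has the opposite sign.\<close>

lemma half_line_cover:
  assumes "0 \<le> sg s * p"
  shows "\<exists>c b. 0 \<le> sg b * (p - 4 * lam * of_int c) \<and> sg b * (p - 4 * lam * of_int c) \<le> 2 * lam
     \<and> 0 \<le> sg s * (4 * lam * of_int c) \<and> 0 \<le> sg s * (4 * lam * of_int c + 2 * lam * sg b)"
proof -
  define v where "v = sg s * p"
  define k where "k = \<lfloor>v / (4 * lam)\<rfloor>"
  have p: "p = sg s * v" by (simp add: v_def)
  have k0: "0 \<le> k" using assms lam_pos by (simp add: k_def v_def)
  have "of_int k \<le> v / (4 * lam)" "v / (4 * lam) < of_int k + 1"
    unfolding k_def by linarith+
  then have v: "4 * lam * of_int k \<le> v" "v < 4 * lam * of_int k + 4 * lam"
    using lam_pos by (auto simp: field_simps)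
  have pos: "0 \<le> lam * of_int k" using k0 lam_pos by simp
  define z where "z = (if s then 1 else - 1 :: int)"
  have z: "of_int z = sg s" by (simp add: z_def sg_def)
  show ?thesis
  proof (cases "v \<le> 4 * lam * of_int k + 2 * lam")
    case True
    then show ?thesis using v pos lam_pos
      by (intro exI[of _ "z * k"] exI[of _ s]) (cases s; simp add: z sg_def p)
  next
    case False
    then show ?thesis using v pos lam_pos
      by (intro exI[of _ "z * (k + 1)"] exI[of _ "\<not> s"]) (cases s; simp add: z sg_def p algebra_simps)
  qed
qed

lemma tile_cover:
  assumes "x \<in> wedge i"
  shows "\<exists>t. x \<in> tile t \<and> tile t \<subseteq> wedge i"
proof -
  obtain s r where i: "i = (s, r)" by (cases i)
  obtain c b where c: "0 \<le> sg b * (x$1 + x$2 - 4 * lam * of_int c)" "sg b * (x$1 + x$2 - 4 * lam * of_int c) \<le> 2 * lam"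
     "0 \<le> sg s * (4 * lam * of_int c)" "0 \<le> sg s * (4 * lam * of_int c + 2 * lam * sg b)"
    using half_line_cover[of s "x$1 + x$2"] assms i by (auto simp: wedge_def)
  obtain d e where d: "0 \<le> sg e * (x$1 - x$2 - 4 * lam * of_int d)" "sg e * (x$1 - x$2 - 4 * lam * of_int d) \<le> 2 * lam"
     "0 \<le> sg r * (4 * lam * of_int d)" "0 \<le> sg r * (4 * lam * of_int d + 2 * lam * sg e)"
    using half_line_cover[of r "x$1 - x$2"] assms i by (auto simp: wedge_def)
  have "x \<in> tile (c, d, b, e)" using c d by simp
  then show ?thesis using tile_subset_wedge[OF c(3,4) d(3,4)] i by blast
qed

lemma wedge_cover: "(\<Union>i. wedge i) = UNIV"
proof -
  have "\<exists>b. 0 \<le> sg b * r" for r by (rule exI[of _ "0 \<le> r"]) (auto simp: sg_def)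
  then have "\<exists>s r. x \<in> wedge (s, r)" for x unfolding wedge_def by simp
  then show ?thesis by blast
qed

lemma even_line_axis:
  assumes "tile t \<subseteq> wedge (s, r)" "t \<noteq> (0, 0, s, r)"
  shows "even_line t \<inter> vaxis = {}"
proof (rule ccontr)
  obtain c d b e where t: "t = (c, d, b, e)" by (cases t)
  assume "even_line t \<inter> vaxis \<noteq> {}"
  then have 0: "c = 0" "d = 0" using lam_pos by (auto simp: t even_line_def vaxis_def diag_line_def)
  \<comment> \<open>This is the centre of the cross section of the tile; its membership in the wedge
    forces the signs of the tile to be those of the wedge.\<close>
  let ?y = "mk3 (lam * (sg b + sg e) / 2) (lam * (sg b - sg e) / 2) 0"
  have y: "?y $ 1 + ?y $ 2 = lam * sg b" "?y $ 1 - ?y $ 2 = lam * sg e"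
    by (simp_all add: field_simps)
  have "?y \<in> tile t" using lam_pos unfolding t 0 by (simp only: tile.simps mem_Collect_eq y) (simp add: mult.left_commute)
  then have "?y \<in> wedge (s, r)" using assms(1) by blast
  then have "0 \<le> sg s * (lam * sg b)" "0 \<le> sg r * (lam * sg e)" by (simp_all only: wedge_def mem_Collect_eq y fst_conv snd_conv)
  then have "s = b" "r = e" using lam_pos by (auto simp: sg_def split: if_splits)
  then show False using assms(2) t 0 by simp
qed

lemma odd_line_axis: "odd_line t \<inter> vaxis = {}"
proof -
  obtain c d b e where t: "t = (c, d, b, e)" by (cases t)
  have "4 * lam * of_int c + 2 * lam * sg b = 2 * lam * of_int (2 * c + (if b then 1 else -1))"
    by (simp add: sg_def algebra_simps)
  moreover have "odd (2 * c + (if b then 1 else -1))" by simp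
  then have "2 * c + (if b then 1 else -1) \<noteq> 0" by (metis even_zero)
  ultimately have "4 * lam * of_int c + 2 * lam * sg b \<noteq> 0" using lam_pos by (simp only: mult_eq_0_iff of_int_eq_0_iff) simp
  then show ?thesis by (auto simp: t odd_line_def vaxis_def diag_line_def)
qed

section \<open>The axis and the orbit of the omitted value\<close>

lemma f_axis: "x \<in> vaxis \<Longrightarrow> f x \<in> vaxis" "x \<in> vaxis \<Longrightarrow> f x $ 3 = radius x"
proof -
  assume x: "x \<in> vaxis"
  note h = axis_half[OF x, of True True]
  show a: "f x \<in> vaxis" using half_axis[OF h] x by blast
  then have "f x $ 1 = 0" "f x $ 2 = 0" by (auto simp: vaxis_def diag_line_def)
  then have "(norm (f x))\<^sup>2 = (f x $ 3)\<^sup>2" by (simp add: norm_vec3_sq)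
  then show "f x $ 3 = radius x"
    using f_half(3)[OF h] radius_pos[of x] by (simp add: norm_f)
qed

lemma axis_escapes: "vaxis \<subseteq> escaping_set f"
proof
  fix x assume x: "x \<in> vaxis"
  have ax: "(f ^^ n) x \<in> vaxis" for n by (induction n) (auto simp: x f_axis)
  \<comment> \<open>Here \<open>nu * lam \<ge> 1\<close> enters: each iterate raises the height on
    the axis by at least 1.\<close>
  have step: "y$3 + 1 \<le> f y $ 3" if "y \<in> vaxis" for y
  proof -
    have "y$3 + 1 \<le> 1 * exp (y$3)" using exp_ge_add_one_self[of "y$3"] by linarith
    also have "\<dots> \<le> nu * lam * exp (y$3)" using nu_lam by (intro mult_right_mono) auto
    finally show ?thesis using f_axis(2)[OF that] by (simp add: radius_def)
  qed
  have "x$3 + real n \<le> (f ^^ n) x $ 3" for n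
  proof (induction n)
    case (Suc n)
    then show ?case using step[OF ax[of n]] by simp
  qed simp
  then have "x$3 + real n \<le> norm ((f ^^ n) x)" for n
    using component_le_norm_cart[of "(f ^^ n) x" 3] by (meson abs_ge_self order_trans)
  moreover have "filterlim (\<lambda>n. x$3 + real n) at_top sequentially"
    by (intro filterlim_tendsto_add_at_top[OF tendsto_const] filterlim_real_sequentially)
  ultimately show "x \<in> escaping_set f"
    unfolding escaping_set_def mem_Collect_eq by (blast intro: filterlim_at_top_mono always_eventually)
qed

definition post :: "(real^3) set" where "post = range (\<lambda>n. (f ^^ n) 0)"

lemma countable_post: "countable post"
  by (simp add: post_def)

lemma post: "post \<subseteq> vaxis" "f ` post \<subseteq> post" "0 \<in> post"
proof -
  have "(f ^^ n) 0 \<in> vaxis" for n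
    by (induction n) (auto simp: mem_vaxis[of 0] intro: f_axis)
  then show "post \<subseteq> vaxis" by (auto simp: post_def)
  show "f ` post \<subseteq> post" 
  proof
    fix y assume "y \<in> f ` post"
    then obtain n where "y = f ((f ^^ n) 0)" by (auto simp: post_def)
    then have "y = (f ^^ Suc n) 0" by simp
    then show "y \<in> post" unfolding post_def by blast
  qed
  show "0 \<in> post" unfolding post_def by (rule image_eqI[of _ _ 0]) auto
qed

text \<open>The norms of \<open>f\<close> along a vertical line fill an interval, while
  \<open>post\<close> is countable.\<close>

lemma diag_line_hits: "\<exists>x\<in>diag_line a b. f x \<notin> post"
proof (rule ccontr)
  assume "\<not> ?thesis"
  then have *: "x \<in> diag_line a b \<Longrightarrow> f x \<in> post" for x by blast
  have "{0<..<1} \<subseteq> norm ` post"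
  proof
    fix r :: real assume r: "r \<in> {0<..<1}"
    let ?x = "mk3 ((a + b) / 2) ((a - b) / 2) (ln (r / (nu * lam)))"
    have "norm (f ?x) = r" using r nu_pos lam_pos by (simp add: norm_f radius_def)
    moreover have "?x \<in> diag_line a b" by (simp add: diag_line_def field_simps)
    ultimately show "r \<in> norm ` post" using * by (metis imageI)
  qed
  then have "countable {0<..<1::real}" using countable_post countable_subset by blast
  then show False using uncountable_open_interval[of 0 "1::real"] by simp
qed

lemma axis_closure: "vaxis \<subseteq> closure (vaxis - post)"
proof
  fix x assume x: "x \<in> vaxis"
  show "x \<in> closure (vaxis - post)"
    unfolding closure_approachable
  proof (intro allI impI)
    fix e :: real assume e: "0 < e"
    have "\<not> {x$3<..<x$3 + e} \<subseteq> (\<lambda>y. y$3) ` post"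
      using uncountable_open_interval[of "x$3" "x$3 + e"] e countable_post
      by (meson countable_image countable_subset less_add_same_cancel1)
    then obtain r where "r \<in> {x$3<..<x$3 + e}" "r \<notin> (\<lambda>y. y$3) ` post" by blast
    then have r: "x$3 < r" "r < x$3 + e" "r \<notin> (\<lambda>y. y$3) ` post" by simp_all
    let ?y = "mk3 0 0 r"
    have "?y \<in> vaxis" by (simp add: vaxis_def diag_line_def)
    moreover have "?y \<notin> post" using r(3) by force
    moreover have "x$1 = 0" "x$2 = 0" using x by (auto simp: vaxis_def diag_line_def)
    then have "dist ?y x < e" using r norm_le_l1_cart[of "?y - x"] by (simp add: dist_norm sum_3)
    ultimately show "\<exists>y\<in>vaxis - post. dist y x < e" by blast
  qed
qed

section \<open>Walking along the edges of a wedge\<close>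

lemma lines_chain:
  assumes S: "S vaxis" and step: "\<And>t. tile t \<subseteq> wedge i \<Longrightarrow> S (even_line t) \<longleftrightarrow> S (odd_line t)"
    and t: "tile t \<subseteq> wedge i"
  shows "S (even_line t)"
proof -
  obtain s r where i: "i = (s, r)" by (cases i)
  define z :: "bool \<Rightarrow> int" where "z b = (if b then 1 else - 1)" for b
  have z: "real_of_int (z b) = sg b" for b by (simp add: z_def sg_def)
  \<comment> \<open>The indices \<open>k\<close> and \<open>l\<close> count outwards from the axis,
    so that one induction serves all four wedges.\<close>
  define E where "E k l = diag_line (4 * lam * of_int (z s * int k)) (4 * lam * of_int (z r * int l))" for k l
  define Od where "Od k l = diag_line (4 * lam * of_int (z s * int k) + 2 * lam * sg s) (4 * lam * of_int (z r * int l) + 2 * lam * sg r)" for k l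
  have nn: "0 \<le> lam * real k" for k using lam_pos by simp
  have out: "S (E k l) \<longleftrightarrow> S (Od k l)" for k l
  proof -
    have "tile (z s * int k, z r * int l, s, r) \<subseteq> wedge i"
      unfolding i using nn[of k] nn[of l] lam_pos
      by (intro tile_subset_wedge) (cases s; cases r; simp add: z sg_def)+
    from step[OF this] show ?thesis by (simp add: E_def Od_def even_line_def odd_line_def)
  qed
  \<comment> \<open>The odd edge \<open>Od k l\<close> is shared with the tile that points back from
    the next even edge; crossing these two tiles moves one step outwards.\<close>
  have right: "S (E (Suc k) l) \<longleftrightarrow> S (Od k l)" for k l
  proof -
    have "tile (z s * int (Suc k), z r * int l, \<not> s, r) \<subseteq> wedge i"
      unfolding i using nn[of k] nn[of l] lam_pos
      by (intro tile_subset_wedge) (cases s; cases r; simp add: z sg_def algebra_simps)+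
    moreover have "4 * lam * of_int (z s * int (Suc k)) + 2 * lam * sg (\<not> s) = 4 * lam * of_int (z s * int k) + 2 * lam * sg s"
      by (cases s) (simp_all add: z sg_def algebra_simps)
    ultimately show ?thesis
      using step[of "(z s * int (Suc k), z r * int l, \<not> s, r)"] by (simp only: E_def Od_def even_line_def odd_line_def prod.case)
  qed
  have up: "S (E k (Suc l)) \<longleftrightarrow> S (Od k l)" for k l
  proof -
    have "tile (z s * int k, z r * int (Suc l), s, \<not> r) \<subseteq> wedge i"
      unfolding i using nn[of k] nn[of l] lam_pos
      by (intro tile_subset_wedge) (cases s; cases r; simp add: z sg_def algebra_simps)+
    moreover have "4 * lam * of_int (z r * int (Suc l)) + 2 * lam * sg (\<not> r) = 4 * lam * of_int (z r * int l) + 2 * lam * sg r"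
      by (cases r) (simp_all add: z sg_def algebra_simps)
    ultimately show ?thesis
      using step[of "(z s * int k, z r * int (Suc l), s, \<not> r)"] by (simp only: E_def Od_def even_line_def odd_line_def prod.case)
  qed
  have "E 0 0 = vaxis" by (simp add: E_def vaxis_def)
  then have "S (E k 0)" for k
    by (induction k) (use S out right in auto)
  then have all: "S (E k l)" for k l
    by (induction l) (use out up in auto)
  obtain c d b e where t': "t = (c, d, b, e)" by (cases t)
  \<comment> \<open>A point of the even edge lies in the wedge, which gives \<open>c\<close> and
    \<open>d\<close> the signs of the wedge and makes the counts natural numbers.\<close>
  let ?y = "mk3 (2 * lam * of_int (c + d)) (2 * lam * of_int (c - d)) 0"
  have "?y \<in> even_line t" by (simp add: t' even_line_def diag_line_def algebra_simps)
  then have "?y \<in> wedge i" using tile_lines t by blast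
  then have "0 \<le> sg s * (4 * lam * of_int c)" "0 \<le> sg r * (4 * lam * of_int d)"
    by (auto simp: i wedge_def algebra_simps)
  then have "0 \<le> z s * c" "0 \<le> z r * d"
    using lam_pos by (auto simp: z_def sg_def zero_le_mult_iff mult_le_0_iff split: if_splits)
  then have "E (nat (z s * c)) (nat (z r * d)) = even_line t"
    by (simp add: E_def t' even_line_def) (simp add: z_def)
  then show ?thesis using all by metis
qed

theorem connected_escaping_set: "connected (escaping_set f)"
proof -
  obtain \<sigma> where \<sigma>: "\<And>i. hh ` tri i = upper_hemisphere \<inter> wedge (\<sigma> i)" using tri_image by metis
  have sub: "tile (0, 0, s, r) \<subseteq> wedge (s, r)" for s r
    using lam_pos by (intro tile_subset_wedge) auto
  interpret expanding_tiling f wedge tile "target_of \<sigma>" "\<lambda>(s, r). (0, 0, s, r)"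
    even_line odd_line vaxis post "4 * (2 * lam * L + 1)" "4 * lam"
  proof unfold_locales
    show "0 < 4 * (2 * lam * L + 1)" using lam_pos L_ge_1 by (simp add: add_pos_pos)
    show "connected (even_line t)" "connected (odd_line t)" for t
      by (auto simp: even_line_def odd_line_def connected_diag_line split: prod.splits)
    show "\<exists>x\<in>even_line t. f x \<notin> post" "\<exists>x\<in>odd_line t. f x \<notin> post" for t
      using diag_line_hits by (auto simp: even_line_def odd_line_def split: prod.splits)
    show "tile (case i of (s, r) \<Rightarrow> (0, 0, s, r)) \<subseteq> wedge i" for i
      using sub by (cases i) auto
    show "even_line (case i of (s, r) \<Rightarrow> (0, 0, s, r)) = vaxis" for i
      by (cases i) (simp add: even_line_def vaxis_def)
    show "even_line t \<inter> vaxis = {}" if "tile t \<subseteq> wedge i" "t \<noteq> (case i of (s, r) \<Rightarrow> (0, 0, s, r))" for t i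
      using even_line_axis that by (cases i) auto
    show "f ` vaxis \<subseteq> vaxis" using f_axis by blast
    show "bij_betw f (tile t) (wedge (target_of \<sigma> t) - {0})" for t
      by (rule tile_bij[OF \<sigma>])
    show "dist x y \<le> 4 * (2 * lam * L + 1) * dist (f x) (f y) / norm (f x)"
      if "x \<in> tile t" "y \<in> tile t" "dist (f x) (f y) \<le> norm (f x) / 2" for x y t
      by (rule tile_expand[OF \<sigma> that])
    show "\<exists>t. x \<in> tile t \<and> tile t \<subseteq> wedge i" if "x \<in> wedge i" for x i
      by (rule tile_cover[OF that])
    show "\<exists>y\<in>odd_line t. dist x y \<le> 4 * lam" if "x \<in> tile t" for x t
      by (rule odd_line_near[OF that])
    show "S (even_line t)"
      if "S vaxis" "\<And>t. tile t \<subseteq> wedge i \<Longrightarrow> S (even_line t) \<longleftrightarrow> S (odd_line t)" "tile t \<subseteq> wedge i" for S i t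
      by (rule lines_chain[OF that])
  qed (rule wedge_cover tile_lines odd_line_axis axis_escapes post axis_closure)+
  show ?thesis by (rule connected_escaping)
qed

end

theorem theorem1p3:
  fixes hh :: "real^2 \<Rightarrow> real^3" and L lam nu :: real
  assumes "zorich_base L hh"
    and "lam > L ^ 5"
    and "nu > sqrt (2 * L / lam)"
  shows "connected (escaping_set (zorich hh lam nu))"
proof -
  have L: "1 \<le> L" using assms(1) by (simp add: zorich_base_def)
  then have lam: "1 < lam" using assms(2) one_le_power[of L 5] by linarith
  \<comment> \<open>The lower bound on \<open>nu\<close> gives
    \<open>nu * lam > sqrt (2 * L * lam)\<close>, and the root is at least 1 because
    \<open>L\<close> and \<open>lam\<close> are.\<close>
  have "1 \<le> 2 * L * lam" using L lam mult_mono[of 1 "2 * L" 1 lam] by simp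
  then have "1 \<le> sqrt (2 * L * lam)" by simp
  also have "\<dots> = sqrt (2 * L / lam) * lam"
    using lam by (simp add: real_sqrt_mult real_sqrt_divide field_simps)
  also have "\<dots> \<le> nu * lam" using assms(3) lam by (intro mult_right_mono) auto
  finally have "1 \<le> nu * lam" .
  then interpret zorich_map hh L lam nu
    using assms(1) lam by unfold_locales auto
  show ?thesis by (rule connected_escaping_set)
qed

end
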